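(* For generic $a\in\mathfrak h^*$ the linear map $g\mapsto f^g_a$ from $\mathcal A\otimes\bar{\mathcal A}$ into the space of collections of functions $\{f^g_a(\theta_1,\dots,\theta_N)_{k_1\dots k_N}\}$ ($N\ge 0$, $1\le k_1,\dots,k_N\le L-1$) is injective; that is, it is invertible as a map onto its image.
   Context: Fix an integer $L\ge2$ and an irrational $p\in(0,1)$; $\omega=e^{2\pi i/L}$ and $\omega^c:=e^{2\pi i c/L}$ for $c\in\mathbb C$. $\mathfrak h^*$ is the complex dual Cartan subalgebra of the Lie algebra $A_{L-1}$ with its invariant bilinear form $\langle\cdot,\cdot\rangle$ and simple roots $\alpha_1,\dots,\alpha_{L-1}$, $\langle\alpha_i,\alpha_j\rangle=2\delta_{ij}-\delta_{i,j+1}-\delta_{i,j-1}$. $H_1,\dots,H_L\in\mathfrak h^*$ are the weights of the first fundamental representation: $\langle\alpha_i,H_s\rangle=\delta_{is}-\delta_{i,s-1}$, so $\alpha_i=H_i-H_{i+1}$ and $\sum_sH_s=0$. For $S\subseteq\{1,\dots,L\}$ put $H_S=\sum_{s\in S}H_s$. Let $$f(z)=\frac{(z-\omega^p)(z-\omega^{1-p})}{(z-1)(z-\omega)}.$$ "For generic $a$" means: for all $a\in\mathfrak h^*$ outside a countable union of zero sets of entire functions on $\mathfrak h^*$ that are not identically zero. **Algebras.** $\mathcal A$ is the free commutative (polynomial) $\mathbb C$-algebra on generators $\alpha_ic_{-n}$, $1\le i\le L-1$, $n\ge1$; $\bar{\mathcal A}$ is a second copy with generators $\alpha_i\bar c_{-n}$.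 **Rational functions $J^g_{N,a}$.** Let $N\ge0$, $k_1,\dots,k_N\in\{1,\dots,L-1\}$, and let $x_1,\dots,x_N$ be variables. For a tuple $\underline S=(S_1,\dots,S_N)$ of subsets of $\{1,\dots,L\}$ with $|S_n|=k_n$, $S_n=\{s^{(n)}_1<\dots<s^{(n)}_{k_n}\}$, put $y^{(n)}_j=x_n\,\omega^{(k_n+1-2j)/2}$. Define the algebra homomorphism $E_{\underline S}$ from $\mathcal A\otimes\bar{\mathcal A}$ to rational functions of $x_1,\dots,x_N$ by $$E_{\underline S}(\alpha_ic_{-m})=\sum_{n=1}^N\sum_{j=1}^{k_n}\langle\alpha_i,H_{s^{(n)}_j}\rangle\,\omega^{-\frac{L+1-2s^{(n)}_j}{2}m}\,(y^{(n)}_j)^m,$$ $$E_{\underline S}(\alpha_i\bar c_{-m})=\sum_{n=1}^N\sum_{j=1}^{k_n}\langle\alpha_i,H_{L+1-s^{(n)}_j}\rangle\,\omega^{\frac{L+1-2s^{(n)}_j}{2}m}\,(y^{(n)}_j)^{-m}.$$ Let $\Phi_{\underline S}(x_1,\dots,x_N)$ be the product, over all $m<n$ and all pairs $(j,j')$ with $s^{(m)}_j\ne s^{(n)}_{j'}$, of the factors $f(y^{(m)}_j/y^{(n)}_{j'})$ if $s^{(m)}_j<s^{(n)}_{j'}$ and $f(y^{(n)}_{j'}/y^{(m)}_j)$ if $s^{(m)}_j>s^{(n)}_{j'}$. Then $$J^g_{N,a}(x_1,\dots,x_N)_{k_1\dots k_N}=\sum_{\underline S}\omega^{\langle a,\sum_nH_{S_n}\rangle}\,\Phi_{\underline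 S}\,E_{\underline S}(g),\qquad g\in\mathcal A\otimes\bar{\mathcal A}.$$ **Form factors.** $$f^g_a(\theta_1,\dots,\theta_N)_{k_1\dots k_N}=J^g_{N,a}(e^{\theta_1},\dots,e^{\theta_N})_{k_1\dots k_N}\prod_{n}\lambda'_{k_n}\prod_{m<n}R_{k_mk_n}(\theta_m-\theta_n),$$ where $R_{kl}(\theta)=\prod_{i=1}^k\prod_{j=1}^lR\bigl(\theta+\frac{i\pi}{L}(k-l-2i+2j)\bigr)$ (the prefactor $i\pi$ contains the imaginary unit, the other $i$ is the product index), $R$ is the meromorphic continuation of $$R(\theta)=\exp\Bigl(-4\int_0^\infty\frac{dt}{t}\,\frac{\sinh((L-1)t)\sinh(pt)\sinh((1-p)t)}{\sinh^2(Lt)}\cosh\frac{L(\pi-\mathrm i\theta)t}{\pi}\Bigr)$$ (the integral converges for $-2\pi<\operatorname{Im}\theta<0$), and $\lambda'_k=\sqrt{\frac{L}{2\sin\pi p}}\exp\int_0^\infty\frac{dt}{t}\frac{\sinh(pt)\sinh((1-p)t)}{\sinh t\,\sinh^2Lt}\bigl(\sinh^2kt+\sinh^2(L-k)t\bigr)$ are nonzero constants. $f^g_a$ denotes the collection of all these meromorphic functions for all $N\ge0$ and all $k_1,\dots,k_N$. *)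

theory Defs
  imports "HOL-Complex_Analysis.Complex_Analysis" "HOL-Library.Poly_Mapping"
begin

section \<open>Weights of \<open>A\<^bsub>L-1\<^esub>\<close>\<close>

text \<open>
  The dual Cartan subalgebra is realised as the trace-zero hyperplane of \<open>\<complex>\<^sup>L\<close>, with coordinates
  indexed by \<open>1, \<dots>, L\<close>; functions vanish outside this index range.  The invariant form is the
  restriction of the bilinear (not sesquilinear) standard form.
\<close>

definition hdual :: "nat \<Rightarrow> (nat \<Rightarrow> complex) set" where
  "hdual L = {a. (\<forall>s. s \<notin> {1..L} \<longrightarrow> a s = 0) \<and> (\<Sum>s=1..L. a s) = 0}"

definition bform :: "nat \<Rightarrow> (nat \<Rightarrow> complex) \<Rightarrow> (nat \<Rightarrow> complex) \<Rightarrow> complex" where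
  "bform L a b = (\<Sum>s=1..L. a s * b s)"

definition weight :: "nat \<Rightarrow> nat \<Rightarrow> nat \<Rightarrow> complex" where
  "weight L s = (\<lambda>t. if t \<in> {1..L} then (if t = s then 1 else 0) - 1 / of_nat L else 0)"

definition simple_root :: "nat \<Rightarrow> nat \<Rightarrow> nat \<Rightarrow> complex" where
  "simple_root L i = (\<lambda>t. weight L i t - weight L (i + 1) t)"

definition weight_sum :: "nat \<Rightarrow> nat set \<Rightarrow> nat \<Rightarrow> complex" where
  "weight_sum L S = (\<lambda>t. \<Sum>s\<in>S. weight L s t)"

lemma sum_weight_coords:
  assumes "s \<in> {1..L}"
  shows "(\<Sum>t=1..L. weight L s t) = 0"
  using assms by (auto simp: weight_def sum_subtractf)

lemma weight_in_hdual: "s \<in> {1..L} \<Longrightarrow> weight L s \<in> hdual L"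
  using sum_weight_coords[of s L] by (auto simp: hdual_def weight_def)

lemma simple_root_in_hdual:
  assumes "i \<in> {1..<L}"
  shows "simple_root L i \<in> hdual L"
  using weight_in_hdual[of i L] weight_in_hdual[of "i + 1" L] assms
  by (auto simp: hdual_def simple_root_def sum_subtractf)

lemma weight_sum_all: "weight_sum L {1..L} = (\<lambda>_. 0)"
proof
  fix t
  show "weight_sum L {1..L} t = 0"
    by (cases "1 \<le> t \<and> t \<le> L") (auto simp: weight_sum_def weight_def sum_subtractf)
qed

lemma bform_simple_root_weight:
  assumes "i \<in> {1..<L}" "s \<in> {1..L}"
  shows "bform L (simple_root L i) (weight L s)
           = (if s = i then 1 else 0) - (if s = i + 1 then 1 else 0)"
proof -
  have root: "simple_root L i t = (if t = i then 1 else 0) - (if t = i + 1 then 1 else 0)"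
    if "t \<in> {1..L}" for t
    using that by (simp add: simple_root_def weight_def)
  have "bform L (simple_root L i) (weight L s)
          = (\<Sum>t=1..L. (if t = i then weight L s t else 0) - (if t = i + 1 then weight L s t else 0))"
    unfolding bform_def by (rule sum.cong) (auto simp: root)
  also have "\<dots> = weight L s i - weight L s (i + 1)"
    using assms by (simp add: sum_subtractf)
  also have "\<dots> = (if s = i then 1 else 0) - (if s = i + 1 then 1 else 0)"
    using assms by (auto simp: weight_def)
  finally show ?thesis .
qed

lemma bform_simple_roots:
  assumes "i \<in> {1..<L}" "j \<in> {1..<L}"
  shows "bform L (simple_root L i) (simple_root L j)
           = (if i = j then 2 else if i = j + 1 \<or> j = i + 1 then - 1 else 0)"
proof -
  have "bform L (simple_root L i) (simple_root L j)
          = bform L (simple_root L i) (weight L j) - bform L (simple_root L i) (weight L (j + 1))"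
    by (simp add: bform_def simple_root_def[of L j] right_diff_distrib sum_subtractf)
  then show ?thesis
    using assms by (auto simp: bform_simple_root_weight)
qed


section \<open>Genericity\<close>

text \<open>
  Entire functions on the finite-dimensional complex vector space \<open>hdual L\<close>: continuous and
  holomorphic along every complex affine line.  Only the values on \<open>hdual L\<close> matter; the
  product topology of \<open>nat \<Rightarrow> complex\<close> induces the usual topology there.
\<close>

definition entire_on_hdual :: "nat \<Rightarrow> ((nat \<Rightarrow> complex) \<Rightarrow> complex) \<Rightarrow> bool" where
  "entire_on_hdual L F \<longleftrightarrow>
     continuous_on (hdual L) F \<and>
     (\<forall>a\<in>hdual L. \<forall>v\<in>hdual L. (\<lambda>z. F (\<lambda>s. a s + z * v s)) holomorphic_on UNIV)"

definition for_generic :: "nat \<Rightarrow> ((nat \<Rightarrow> complex) \<Rightarrow> bool) \<Rightarrow> bool" where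
  "for_generic L P \<longleftrightarrow>
     (\<exists>\<F>. countable \<F> \<and>
        (\<forall>F\<in>\<F>. entire_on_hdual L F \<and> (\<exists>b\<in>hdual L. F b \<noteq> 0)) \<and>
        (\<forall>a\<in>hdual L. (\<forall>F\<in>\<F>. F a \<noteq> 0) \<longrightarrow> P a))"


section \<open>The algebra of generators\<close>

text \<open>
  The tensor product of the two polynomial algebras is the polynomial algebra on the disjoint
  union of their generators.  \<open>Gen i n\<close> stands for \<open>\<alpha>\<^sub>i c\<^bsub>-n\<^esub>\<close> and \<open>GenBar i n\<close> for its barred copy.
  Multivariate polynomials are finitely supported maps from monomials (finitely supported
  exponent functions) to coefficients; the product on this type is convolution.
\<close>

datatype gen = Gen nat nat | GenBar nat nat

type_synonym gen_poly = "(gen \<Rightarrow>\<^sub>0 nat) \<Rightarrow>\<^sub>0 complex"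

definition gens :: "nat \<Rightarrow> gen set" where
  "gens L = {Gen i n | i n. i \<in> {1..L-1} \<and> n \<ge> 1} \<union> {GenBar i n | i n. i \<in> {1..L-1} \<and> n \<ge> 1}"

definition algebra_AA :: "nat \<Rightarrow> gen_poly set" where
  "algebra_AA L = {g. \<forall>m\<in>Poly_Mapping.keys g. Poly_Mapping.keys m \<subseteq> gens L}"

definition monom_eval :: "(gen \<Rightarrow> complex) \<Rightarrow> (gen \<Rightarrow>\<^sub>0 nat) \<Rightarrow> complex" where
  "monom_eval e m = (\<Prod>v\<in>Poly_Mapping.keys m. e v ^ Poly_Mapping.lookup m v)"

definition poly_eval :: "(gen \<Rightarrow> complex) \<Rightarrow> gen_poly \<Rightarrow> complex" where
  "poly_eval e g = (\<Sum>m\<in>Poly_Mapping.keys g. Poly_Mapping.lookup g m * monom_eval e m)"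

text \<open>\<open>poly_eval e\<close> is the algebra homomorphism determined by the values \<open>e\<close> on generators.\<close>

lemma monom_eval_superset:
  assumes "finite A" "Poly_Mapping.keys m \<subseteq> A"
  shows "monom_eval e m = (\<Prod>v\<in>A. e v ^ Poly_Mapping.lookup m v)"
  unfolding monom_eval_def using assms
  by (intro prod.mono_neutral_left) (auto simp: in_keys_iff)

lemma monom_eval_add: "monom_eval e (m + m') = monom_eval e m * monom_eval e m'"
proof -
  let ?A = "Poly_Mapping.keys m \<union> Poly_Mapping.keys m'"
  have "monom_eval e (m + m') = (\<Prod>v\<in>?A. e v ^ Poly_Mapping.lookup (m + m') v)"
    by (rule monom_eval_superset) (auto simp: keys_add)
  also have "\<dots> = (\<Prod>v\<in>?A. e v ^ Poly_Mapping.lookup m v) * (\<Prod>v\<in>?A. e v ^ Poly_Mapping.lookup m' v)"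
    by (simp add: lookup_add power_add prod.distrib)
  also have "\<dots> = monom_eval e m * monom_eval e m'"
    by (simp add: monom_eval_superset[of ?A])
  finally show ?thesis .
qed

lemma poly_eval_superset:
  assumes "finite A" "Poly_Mapping.keys g \<subseteq> A"
  shows "poly_eval e g = (\<Sum>m\<in>A. Poly_Mapping.lookup g m * monom_eval e m)"
  unfolding poly_eval_def using assms
  by (intro sum.mono_neutral_left) (auto simp: in_keys_iff)

lemma poly_eval_add: "poly_eval e (g + h) = poly_eval e g + poly_eval e h"
proof -
  let ?A = "Poly_Mapping.keys g \<union> Poly_Mapping.keys h"
  have "Poly_Mapping.keys (g + h) \<subseteq> ?A"
    by (rule keys_add)
  then show ?thesis
    by (simp add: poly_eval_superset[of ?A] lookup_add distrib_right sum.distrib)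
qed

lemma poly_eval_single: "poly_eval e (Poly_Mapping.single m c) = c * monom_eval e m"
  by (simp add: poly_eval_def)

lemma poly_eval_gen: "poly_eval e (Poly_Mapping.single (Poly_Mapping.single v 1) 1) = e v"
  by (simp add: poly_eval_single monom_eval_def)

lemma poly_eval_zero: "poly_eval e 0 = 0"
  by (simp add: poly_eval_def)

lemma poly_eval_one: "poly_eval e 1 = 1"
  by (simp add: poly_eval_def monom_eval_def)

lemma poly_eval_sum: "poly_eval e (sum g A) = (\<Sum>x\<in>A. poly_eval e (g x))"
  by (induction A rule: infinite_finite_induct) (simp_all add: poly_eval_zero poly_eval_add)

lemma gen_poly_as_sum:
  fixes g :: gen_poly
  shows "g = (\<Sum>m\<in>Poly_Mapping.keys g. Poly_Mapping.single m (Poly_Mapping.lookup g m))"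
  by (rule poly_mapping_eqI) (auto simp: lookup_sum lookup_single when_def in_keys_iff)

lemma poly_eval_mult: "poly_eval e (g * h) = poly_eval e g * poly_eval e h"
proof -
  have "poly_eval e (g * h) =
      poly_eval e ((\<Sum>m\<in>Poly_Mapping.keys g. Poly_Mapping.single m (Poly_Mapping.lookup g m)) *
                   (\<Sum>m\<in>Poly_Mapping.keys h. Poly_Mapping.single m (Poly_Mapping.lookup h m)))"
    using gen_poly_as_sum by metis
  also have "\<dots> = poly_eval e g * poly_eval e h"
    by (simp add: sum_product mult_single poly_eval_sum poly_eval_single monom_eval_add
        poly_eval_def[of e g] poly_eval_def[of e h] mult_ac)
  finally show ?thesis .
qed


section \<open>The rational functions\<close>

definition omega_pow :: "nat \<Rightarrow> complex \<Rightarrow> complex" where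
  "omega_pow L c = exp (2 * of_real pi * \<i> * c / of_nat L)"

definition f_fun :: "nat \<Rightarrow> real \<Rightarrow> complex \<Rightarrow> complex" where
  "f_fun L p z =
     ((z - omega_pow L (of_real p)) * (z - omega_pow L (1 - of_real p)))
       / ((z - 1) * (z - omega_pow L 1))"

text \<open>
  An \<open>N\<close>-tuple is an extensional function on \<open>{1..N}\<close>.
\<close>

definition subset_tuples :: "nat \<Rightarrow> nat \<Rightarrow> (nat \<Rightarrow> nat) \<Rightarrow> (nat \<Rightarrow> nat set) set" where
  "subset_tuples L N k = (\<Pi>\<^sub>E n\<in>{1..N}. {S. S \<subseteq> {1..L} \<and> card S = k n})"

definition elt :: "(nat \<Rightarrow> nat set) \<Rightarrow> nat \<Rightarrow> nat \<Rightarrow> nat" where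
  "elt S n j = sorted_list_of_set (S n) ! (j - 1)"

definition y_pt :: "nat \<Rightarrow> (nat \<Rightarrow> nat) \<Rightarrow> (nat \<Rightarrow> complex) \<Rightarrow> nat \<Rightarrow> nat \<Rightarrow> complex" where
  "y_pt L k x n j = x n * omega_pow L ((of_nat (k n) + 1 - 2 * of_nat j) / 2)"

fun E_gen :: "nat \<Rightarrow> nat \<Rightarrow> (nat \<Rightarrow> nat) \<Rightarrow> (nat \<Rightarrow> nat set) \<Rightarrow> (nat \<Rightarrow> complex) \<Rightarrow> gen \<Rightarrow> complex" where
  "E_gen L N k S x (Gen i m) =
     (\<Sum>n=1..N. \<Sum>j=1..k n.
        bform L (simple_root L i) (weight L (elt S n j))
        * omega_pow L (- ((of_nat L + 1 - 2 * of_nat (elt S n j)) / 2) * of_nat m)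
        * y_pt L k x n j ^ m)"
| "E_gen L N k S x (GenBar i m) =
     (\<Sum>n=1..N. \<Sum>j=1..k n.
        bform L (simple_root L i) (weight L (L + 1 - elt S n j))
        * omega_pow L ((of_nat L + 1 - 2 * of_nat (elt S n j)) / 2 * of_nat m)
        * y_pt L k x n j powi (- int m))"

definition Phi_fun ::
    "nat \<Rightarrow> real \<Rightarrow> nat \<Rightarrow> (nat \<Rightarrow> nat) \<Rightarrow> (nat \<Rightarrow> nat set) \<Rightarrow> (nat \<Rightarrow> complex) \<Rightarrow> complex" where
  "Phi_fun L p N k S x =
     (\<Prod>n=1..N. \<Prod>m=1..<n. \<Prod>j=1..k m. \<Prod>j'=1..k n.
        if elt S m j < elt S n j' then f_fun L p (y_pt L k x m j / y_pt L k x n j')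
        else if elt S m j > elt S n j' then f_fun L p (y_pt L k x n j' / y_pt L k x m j)
        else 1)"

definition J_fun ::
    "nat \<Rightarrow> real \<Rightarrow> (nat \<Rightarrow> complex) \<Rightarrow> gen_poly \<Rightarrow> nat \<Rightarrow> (nat \<Rightarrow> nat) \<Rightarrow> (nat \<Rightarrow> complex) \<Rightarrow> complex" where
  "J_fun L p a g N k x =
     (\<Sum>S\<in>subset_tuples L N k.
        omega_pow L (bform L a (\<lambda>t. \<Sum>n=1..N. weight_sum L (S n) t))
        * Phi_fun L p N k S x * poly_eval (E_gen L N k S x) g)"


section \<open>The form factors\<close>

definition R_integral :: "nat \<Rightarrow> real \<Rightarrow> complex \<Rightarrow> complex" where
  "R_integral L p \<theta> =
     exp (- 4 * (LBINT t:{0<..}.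
        of_real (1 / t * (sinh ((real L - 1) * t) * sinh (p * t) * sinh ((1 - p) * t)
                           / (sinh (real L * t))\<^sup>2))
        * cosh (of_nat L * (of_real pi - \<i> * \<theta>) * of_real t / of_real pi)))"

text \<open>
  The meromorphic continuation of the integral representation from its strip of convergence;
  a nicely meromorphic function has no removable singularities and takes the value \<open>0\<close> at its poles,
  which makes the continuation unique as a function on \<open>\<complex>\<close>.  Inside the strip the continuation is
  the integral itself.
\<close>

definition R_fun :: "nat \<Rightarrow> real \<Rightarrow> complex \<Rightarrow> complex" where
  "R_fun L p \<theta> =
     (if - 2 * pi < Im \<theta> \<and> Im \<theta> < 0 then R_integral L p \<theta>
      else (THE F. F nicely_meromorphic_on UNIV \<and>
                   (\<forall>z. - 2 * pi < Im z \<and> Im z < 0 \<longrightarrow> F z = R_integral L p z)) \<theta>)"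

definition R_kl :: "nat \<Rightarrow> real \<Rightarrow> nat \<Rightarrow> nat \<Rightarrow> complex \<Rightarrow> complex" where
  "R_kl L p k l \<theta> =
     (\<Prod>i=1..k. \<Prod>j=1..l.
        R_fun L p (\<theta> + \<i> * of_real pi / of_nat L
                        * (of_nat k - of_nat l - 2 * of_nat i + 2 * of_nat j)))"

definition lambda' :: "nat \<Rightarrow> real \<Rightarrow> nat \<Rightarrow> real" where
  "lambda' L p k =
     sqrt (real L / (2 * sin (pi * p)))
     * exp (LBINT t:{0<..}.
         1 / t * (sinh (p * t) * sinh ((1 - p) * t) / (sinh t * (sinh (real L * t))\<^sup>2))
         * ((sinh (real k * t))\<^sup>2 + (sinh ((real L - real k) * t))\<^sup>2))"

text \<open>
  Points at which no denominator of any \<open>\<Phi>\<close>-factor vanishes.  For given \<open>N\<close> and \<open>k\<close> this is a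
  connected dense open subset of \<open>\<complex>\<^sup>N\<close> that does not depend on \<open>g\<close>.
\<close>

definition regular_point :: "nat \<Rightarrow> nat \<Rightarrow> (nat \<Rightarrow> nat) \<Rightarrow> (nat \<Rightarrow> complex) \<Rightarrow> bool" where
  "regular_point L N k \<theta> \<longleftrightarrow>
     (\<forall>n\<in>{1..N}. \<forall>m\<in>{1..<n}. \<forall>j\<in>{1..k m}. \<forall>j'\<in>{1..k n}.
        y_pt L k (\<lambda>r. exp (\<theta> r)) m j / y_pt L k (\<lambda>r. exp (\<theta> r)) n j'
          \<notin> {1, omega_pow L 1, omega_pow L (- 1)})"

text \<open>
  The meromorphic function \<open>f\<^sup>g\<^sub>a(\<theta>\<^sub>1, \<dots>, \<theta>\<^sub>N)\<^bsub>k\<^sub>1\<dots>k\<^sub>N\<^esub>\<close> is represented by its values at the regular points,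
  extended by \<open>0\<close>.  Without this restriction, the convention \<open>x / 0 = 0\<close> would
  attach \<open>g\<close>-dependent values to the poles, and equality of the representing functions would be stronger
  than equality of meromorphic functions.  At poles of an \<open>R\<close>-factor the value
  is \<open>0\<close> for every \<open>g\<close>.
\<close>

definition form_factor ::
    "nat \<Rightarrow> real \<Rightarrow> (nat \<Rightarrow> complex) \<Rightarrow> gen_poly \<Rightarrow> nat \<Rightarrow> (nat \<Rightarrow> nat) \<Rightarrow> (nat \<Rightarrow> complex) \<Rightarrow> complex" where
  "form_factor L p a g N k \<theta> =
     (if regular_point L N k \<theta> then
        J_fun L p a g N k (\<lambda>n. exp (\<theta> n))
        * (\<Prod>n=1..N. of_real (lambda' L p (k n)))
        * (\<Prod>n=1..N. \<Prod>m=1..<n. R_kl L p (k m) (k n) (\<theta> m - \<theta> n))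
      else 0)"

text \<open>
  The whole collection, as one function of \<open>N\<close>, \<open>k\<close> and \<open>\<theta>\<close>, extended by \<open>0\<close> to
  arguments that are not in the index range.
\<close>

definition form_factors ::
    "nat \<Rightarrow> real \<Rightarrow> (nat \<Rightarrow> complex) \<Rightarrow> gen_poly \<Rightarrow> nat \<times> (nat \<Rightarrow> nat) \<times> (nat \<Rightarrow> complex) \<Rightarrow> complex" where
  "form_factors L p a g =
     (\<lambda>(N, k, \<theta>). if k \<in> {1..N} \<rightarrow>\<^sub>E {1..L-1} \<and> \<theta> \<in> {1..N} \<rightarrow>\<^sub>E UNIV
                  then form_factor L p a g N k \<theta> else 0)"

lemma J_fun_add: "J_fun L p a (g + h) N k x = J_fun L p a g N k x + J_fun L p a h N k x"
  by (simp add: J_fun_def poly_eval_add distrib_left sum.distrib)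

lemma J_fun_scale:
  "J_fun L p a (Poly_Mapping.single 0 c * g) N k x = c * J_fun L p a g N k x"
  by (simp add: J_fun_def poly_eval_mult poly_eval_single monom_eval_def sum_distrib_left mult_ac)

lemma form_factors_add:
  "form_factors L p a (g + h) X = form_factors L p a g X + form_factors L p a h X"
  by (cases X) (simp add: form_factors_def form_factor_def J_fun_add distrib_right)

lemma form_factors_scale:
  "form_factors L p a (Poly_Mapping.single 0 c * g) X = c * form_factors L p a g X"
  by (cases X) (simp add: form_factors_def form_factor_def J_fun_scale)

end

theory Submission
  imports Defs
begin

text \<open>
  Only particles of type \<open>1\<close> are needed.  On a product of narrow strips all arguments of \<open>R\<close> lie in the
  strip where \<open>R\<close> is an exponential, so the vanishing of \<open>f\<^sup>g\<^sub>a\<close> forces the entire function of \<open>\<theta>\<close> obtained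
  by clearing the denominators of \<open>J\<^sup>g\<^sub>N\<close> to vanish everywhere, in particular at the poles of \<open>J\<^sup>g\<^sub>N\<close>.
  At a chain of poles \<open>x, \<omega>\<^sup>-\<^sup>1 x, \<dots>, \<omega>\<^sup>1\<^sup>-\<^sup>k x\<close> only the terms with increasing weights \<open>s\<^sub>1 < \<dots> < s\<^sub>k\<close>
  survive (the particle of type \<open>k\<close> as a bound state), and as \<open>a\<close> tends to infinity in a suitable
  direction the term \<open>s\<^sub>j = j\<close> dominates.  There \<open>\<alpha>\<^sub>i c\<^bsub>-m\<^esub>\<close> and \<open>\<alpha>\<^sub>i c\<^bsub>-m\<^esub>\<close> with a bar become
  multiples of the power sums of order \<open>m\<close> over the chains of length \<open>i\<close> and of order \<open>-m\<close> over those of length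
  \<open>L - i\<close>, and these are algebraically independent.  Hence, for each of
  the countably many finite sets of monomials, elimination yields an entire function of \<open>a\<close>, nonzero far
  out in that direction, off whose zeros no nontrivial combination of these monomials is in the kernel.
\<close>

section \<open>Clearing denominators\<close>

lemma omega_pow_0 [simp]: "omega_pow L 0 = 1"
  by (simp add: omega_pow_def)

lemma omega_pow_nonzero [simp]: "omega_pow L c \<noteq> 0"
  by (simp add: omega_pow_def)

lemma omega_pow_add: "omega_pow L (a + b) = omega_pow L a * omega_pow L b"
  by (simp add: omega_pow_def distrib_left add_divide_distrib exp_add)

lemma omega_pow_minus: "omega_pow L (- a) = inverse (omega_pow L a)"
  by (simp add: omega_pow_def exp_minus)

lemma omega_pow_power: "omega_pow L c ^ m = omega_pow L (of_nat m * c)"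
  by (simp add: omega_pow_def exp_of_nat_mult[symmetric] mult_ac)

lemma omega_pow_powi: "omega_pow L c powi k = omega_pow L (of_int k * c)"
  by (simp add: omega_pow_def exp_power_int mult_ac)

lemma norm_omega_pow_of_real [simp]: "norm (omega_pow L (of_real c)) = 1"
proof -
  have "omega_pow L (of_real c) = exp (\<i> * of_real (2 * pi * c / L))"
    by (simp add: omega_pow_def mult_ac)
  then show ?thesis by (metis norm_exp_i_times)
qed

lemma norm_omega_pow_simps [simp]:
  "norm (omega_pow L (of_nat n)) = 1" "norm (omega_pow L (- of_nat n)) = 1"
  "norm (omega_pow L 1) = 1" "norm (omega_pow L (1 - of_real p)) = 1"
  using norm_omega_pow_of_real[of L "of_nat n"] norm_omega_pow_of_real[of L "- of_nat n"]
    norm_omega_pow_of_real[of L 1] norm_omega_pow_of_real[of L "1 - p"]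
  by simp_all

lemma omega_pow_of_real_eqD:
  assumes "L > 0" "omega_pow L (of_real c) = omega_pow L (of_real d)"
  shows "\<exists>k::int. c - d = of_int k * real L"
proof -
  have "exp (2 * of_real pi * \<i> * of_real c / of_nat L) = exp (2 * of_real pi * \<i> * of_real d / of_nat L)"
    using assms(2) by (simp add: omega_pow_def)
  then obtain n :: int where "2 * of_real pi * \<i> * of_real c / of_nat L
      = 2 * of_real pi * \<i> * of_real d / of_nat L + (of_int (2 * n) * pi) * \<i>"
    unfolding exp_eq by blast
  from arg_cong[OF this, of Im] have "2 * pi * c / L = 2 * pi * d / L + 2 * n * pi"
    by simp
  then have "2 * pi * c = 2 * pi * d + (2 * n * pi) * L"
    using assms(1) by (simp add: field_simps)
  then have "2 * pi * (c - d) = 2 * pi * (n * L)"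
    by (simp add: algebra_simps)
  then have "c - d = of_int n * real L" by simp
  then show ?thesis by blast
qed

lemma omega_pow_of_nat_neq_1:
  assumes "0 < d" "d < L"
  shows "omega_pow L (of_nat d) \<noteq> 1"
proof
  assume "omega_pow L (of_nat d) = 1"
  with omega_pow_of_real_eqD[of L "of_nat d" 0] assms obtain k :: int where "real d = k * real L"
    by auto
  then have "int d = k * int L"
    by (metis of_int_eq_iff of_int_mult of_int_of_nat_eq)
  then have "int L dvd int d" by simp
  with assms show False by (simp add: nat_dvd_not_less)
qed

text \<open>Irrationality of \<open>p\<close> makes \<open>d - p\<close> and
  \<open>d - (1 - p)\<close> non-integral, so the zeros of \<open>f_fun\<close> never fall on the
  ratios that occur within a chain.\<close>

lemma omega_pow_of_nat_neq_irrational: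
  assumes "L > 0" "p \<notin> \<rat>"
  shows "omega_pow L (of_nat d) \<noteq> omega_pow L (of_real p)"
    and "omega_pow L (of_nat d) \<noteq> omega_pow L (1 - of_real p)"
proof -
  have False if "real d - p = of_int k * real L" for k :: int
  proof -
    have "p = real d - of_int k * real L" using that by simp
    also have "\<dots> \<in> \<rat>" by simp
    finally show False using assms by simp
  qed
  then show "omega_pow L (of_nat d) \<noteq> omega_pow L (of_real p)"
    using omega_pow_of_real_eqD[of L "of_nat d" p] assms by auto
  have False if "real d - (1 - p) = of_int k * real L" for k :: int
  proof -
    have "p = 1 - real d + of_int k * real L" using that by simp
    also have "\<dots> \<in> \<rat>" by simp
    finally show False using assms by simp
  qed
  then show "omega_pow L (of_nat d) \<noteq> omega_pow L (1 - of_real p)"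
    using omega_pow_of_real_eqD[of L "of_nat d" "1 - p"] assms by auto
qed

section \<open>Two-particle factors over a common denominator\<close>

definition pair_den :: "nat \<Rightarrow> complex \<Rightarrow> complex \<Rightarrow> complex" where
  "pair_den L x y = (x - y) * (x - omega_pow L 1 * y) * (y - omega_pow L 1 * x)"

text \<open>\<open>pair_den\<close> collects the poles of both \<open>f_fun L p (x / y)\<close> and
  \<open>f_fun L p (y / x)\<close>, so one denominator serves every choice of weights. It is
  antisymmetric in \<open>x\<close> and \<open>y\<close>; hence the minus sign in the second
  branch.\<close>

definition pair_num :: "nat \<Rightarrow> real \<Rightarrow> nat \<Rightarrow> nat \<Rightarrow> complex \<Rightarrow> complex \<Rightarrow> complex" where
  "pair_num L p s s' x y =
     (if s < s' then
        (x - omega_pow L (of_real p) * y) * (x - omega_pow L (1 - of_real p) * y) * (y - omega_pow L 1 * x)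
      else if s' < s then
        - ((y - omega_pow L (of_real p) * x) * (y - omega_pow L (1 - of_real p) * x) * (x - omega_pow L 1 * y))
      else pair_den L x y)"

lemma f_fun_mult_den:
  assumes "x \<noteq> 0" "y \<noteq> 0" "pair_den L x y \<noteq> 0"
  shows "(if s < s' then f_fun L p (x / y) else if s > s' then f_fun L p (y / x) else 1) * pair_den L x y
           = pair_num L p s s' x y"
proof -
  have nz: "x - y \<noteq> 0" "x - omega_pow L 1 * y \<noteq> 0" "y - omega_pow L 1 * x \<noteq> 0"
    using assms(3) by (auto simp: pair_den_def)
  have f: "f_fun L p (u / v) = (u - omega_pow L (of_real p) * v) * (u - omega_pow L (1 - of_real p) * v)
      / ((u - v) * (u - omega_pow L 1 * v))" if "v \<noteq> 0" for u v
  proof -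
    have "u / v - c = (u - c * v) / v" for c
      using that by (simp add: field_simps)
    moreover from this[of 1] have "u / v - 1 = (u - v) / v" by simp
    ultimately show ?thesis using that by (simp add: f_fun_def)
  qed
  have den': "pair_den L x y = - ((y - x) * (y - omega_pow L 1 * x) * (x - omega_pow L 1 * y))"
    by (simp add: pair_den_def algebra_simps)
  have cancel: "a / b * (b * c) = a * c" "a / b * - (b * c) = - (a * c)" if "b \<noteq> 0" for a b c :: complex
    using that by simp_all
  consider "s < s'" | "s' < s" | "s = s'" by linarith
  then show ?thesis
  proof cases
    case 1
    then show ?thesis
      using nz f[OF assms(2), of x] cancel(1)[of "(x - y) * (x - omega_pow L 1 * y)"]
      by (simp add: pair_num_def pair_den_def del: mult_minus_right)
  next
    case 2
    then show ?thesis
      using nz f[OF assms(1), of y] cancel(2)[of "(y - x) * (y - omega_pow L 1 * x)"]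
      by (simp add: pair_num_def den' del: mult_minus_right)
  qed (simp add: pair_num_def)
qed

text \<open>The summand of \<open>E_gen\<close> for one particle of type \<open>1\<close>, where
  \<open>y_pt\<close> reduces to the variable itself.\<close>

fun particle_val :: "nat \<Rightarrow> nat \<Rightarrow> complex \<Rightarrow> gen \<Rightarrow> complex" where
  "particle_val L s x (Gen i m) =
     bform L (simple_root L i) (weight L s)
     * omega_pow L (- ((of_nat L + 1 - 2 * of_nat s) / 2) * of_nat m) * x ^ m"
| "particle_val L s x (GenBar i m) =
     bform L (simple_root L i) (weight L (L + 1 - s))
     * omega_pow L ((of_nat L + 1 - 2 * of_nat s) / 2 * of_nat m) * x powi (- int m)"

text \<open>
  \<open>J\<close> for \<open>N\<close> particles of type \<open>1\<close>, multiplied by the common denominator of all the \<open>\<Phi>\<close>-factors.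
\<close>

definition J_num ::
    "nat \<Rightarrow> real \<Rightarrow> (nat \<Rightarrow> complex) \<Rightarrow> gen_poly \<Rightarrow> nat \<Rightarrow> (nat \<Rightarrow> complex) \<Rightarrow> complex" where
  "J_num L p a g N x =
     (\<Sum>s\<in>{1..N} \<rightarrow>\<^sub>E {1..L}.
        omega_pow L (\<Sum>n=1..N. a (s n))
        * (\<Prod>n=1..N. \<Prod>m=1..<n. pair_num L p (s m) (s n) (x m) (x n))
        * poly_eval (\<lambda>v. \<Sum>n=1..N. particle_val L (s n) (x n) v) g)"

text \<open>The shift by \<open>1 / L\<close> in \<open>weight\<close> pairs with the coordinate sum
  of \<open>a\<close>, which is zero on \<open>hdual L\<close>.\<close>

lemma bform_weight:
  assumes "a \<in> hdual L" "s \<in> {1..L}"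
  shows "bform L a (weight L s) = a s"
proof -
  have "bform L a (weight L s) = (\<Sum>t=1..L. (if t = s then a t else 0) - a t / of_nat L)"
    unfolding bform_def by (rule sum.cong) (auto simp: weight_def algebra_simps)
  also have "\<dots> = a s - (\<Sum>t=1..L. a t) / of_nat L"
    using assms by (simp add: sum_subtractf sum_divide_distrib)
  finally show ?thesis using assms by (simp add: hdual_def)
qed

abbreviation all_one :: "nat \<Rightarrow> nat \<Rightarrow> nat" where
  "all_one N \<equiv> (\<lambda>n\<in>{1..N}. 1)"

lemma bij_betw_singleton_tuples:
  "bij_betw (\<lambda>s. \<lambda>n\<in>{1..N}. {s n}) ({1..N} \<rightarrow>\<^sub>E {1..L}) (subset_tuples L N (all_one N))"
proof (rule bij_betw_byWitness[where f' = "\<lambda>S. \<lambda>n\<in>{1..N}. the_elem (S n)"])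
  show "\<forall>s\<in>{1..N} \<rightarrow>\<^sub>E {1..L}. (\<lambda>n\<in>{1..N}. the_elem ((\<lambda>n\<in>{1..N}. {s n}) n)) = s"
    by (auto simp: fun_eq_iff restrict_def PiE_def extensional_def)
  have "(\<lambda>n\<in>{1..N}. {(\<lambda>n\<in>{1..N}. the_elem (S n)) n}) = S"
    if "S \<in> subset_tuples L N (all_one N)" for S
  proof
    fix n
    show "(\<lambda>n\<in>{1..N}. {(\<lambda>n\<in>{1..N}. the_elem (S n)) n}) n = S n"
    proof (cases "n \<in> {1..N}")
      case True
      with that have "card (S n) = 1" by (auto simp: subset_tuples_def PiE_def Pi_def)
      then obtain u where "S n = {u}" by (auto simp: card_1_singleton_iff)
      with True show ?thesis by simp
    next
      case False
      with that show ?thesis by (auto simp: subset_tuples_def PiE_def extensional_def)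
    qed
  qed
  then show "\<forall>S\<in>subset_tuples L N (all_one N). (\<lambda>n\<in>{1..N}. {(\<lambda>n\<in>{1..N}. the_elem (S n)) n}) = S"
    by blast
  show "(\<lambda>s. \<lambda>n\<in>{1..N}. {s n}) ` ({1..N} \<rightarrow>\<^sub>E {1..L}) \<subseteq> subset_tuples L N (all_one N)"
    by (fastforce simp: subset_tuples_def PiE_def Pi_def)
  show "(\<lambda>S. \<lambda>n\<in>{1..N}. the_elem (S n)) ` subset_tuples L N (all_one N) \<subseteq> {1..N} \<rightarrow>\<^sub>E {1..L}"
  proof (intro subsetI PiE_I)
    fix t n assume t: "t \<in> (\<lambda>S. \<lambda>n\<in>{1..N}. the_elem (S n)) ` subset_tuples L N (all_one N)"
      and n: "n \<in> {1..N}"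
    then obtain S where S: "S \<in> subset_tuples L N (all_one N)" "t n = the_elem (S n)" by auto
    with n have "card (S n) = 1" "S n \<subseteq> {1..L}" by (auto simp: subset_tuples_def PiE_def Pi_def)
    then obtain u where "S n = {u}" by (auto simp: card_1_singleton_iff)
    with \<open>S n \<subseteq> {1..L}\<close> S show "t n \<in> {1..L}" by simp
  qed auto
qed

text \<open>For type \<open>1\<close> the subsets are singletons \<open>{s n}\<close>, so the sum
  runs over weight indices, and the denominator distributes over the pairs
  \<open>m < n\<close>.\<close>

lemma J_fun_mult_den:
  assumes a: "a \<in> hdual L" and x: "\<And>n. n \<in> {1..N} \<Longrightarrow> x n \<noteq> 0"
    and den: "\<And>m n. n \<in> {1..N} \<Longrightarrow> m \<in> {1..<n} \<Longrightarrow> pair_den L (x m) (x n) \<noteq> 0"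
  shows "J_fun L p a g N (all_one N) x * (\<Prod>n=1..N. \<Prod>m=1..<n. pair_den L (x m) (x n)) = J_num L p a g N x"
proof -
  define S :: "(nat \<Rightarrow> nat) \<Rightarrow> nat \<Rightarrow> nat set" where "S = (\<lambda>s. \<lambda>n\<in>{1..N}. {s n})"
  have elt: "elt (S s) n (Suc 0) = s n" if "n \<in> {1..N}" for s n
    using that by (simp add: elt_def S_def)
  \<comment> \<open>For \<open>k = 1\<close> and \<open>j = 1\<close> the exponent
    \<open>(k + 1 - 2 * j) / 2\<close> is zero.\<close>
  have y: "y_pt L (\<lambda>n\<in>{Suc 0..N}. Suc 0) x n (Suc 0) = x n" if "n \<in> {1..N}" for n
    using that by (simp add: y_pt_def)
  have "J_fun L p a g N (all_one N) x * (\<Prod>n=1..N. \<Prod>m=1..<n. pair_den L (x m) (x n)) =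
     (\<Sum>s\<in>{1..N} \<rightarrow>\<^sub>E {1..L}.
        omega_pow L (bform L a (\<lambda>t. \<Sum>n=1..N. weight_sum L (S s n) t))
        * Phi_fun L p N (all_one N) (S s) x * poly_eval (E_gen L N (all_one N) (S s) x) g)
      * (\<Prod>n=1..N. \<Prod>m=1..<n. pair_den L (x m) (x n))"
    unfolding J_fun_def
    by (subst sum.reindex_bij_betw[OF bij_betw_singleton_tuples, symmetric]) (simp add: S_def)
  also have "\<dots> = J_num L p a g N x"
    unfolding J_num_def sum_distrib_right
  proof (rule sum.cong)
    fix s assume s: "s \<in> {1..N} \<rightarrow>\<^sub>E {1..L}"
    have "bform L a (\<lambda>t. \<Sum>n=1..N. weight_sum L (S s n) t) = (\<Sum>n=1..N. bform L a (weight L (s n)))"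
    proof -
      have "(\<lambda>t. \<Sum>n=1..N. weight_sum L (S s n) t) = (\<lambda>t. \<Sum>n=1..N. weight L (s n) t)"
        by (intro ext sum.cong) (auto simp: weight_sum_def S_def)
      from fun_cong[OF this] show ?thesis
        unfolding bform_def by (subst sum.swap) (simp only: sum_distrib_left)
    qed
    also have "\<dots> = (\<Sum>n=1..N. a (s n))"
      using s by (intro sum.cong bform_weight[OF a]) (auto simp: PiE_def Pi_def)
    finally have 1: "bform L a (\<lambda>t. \<Sum>n=1..N. weight_sum L (S s n) t) = (\<Sum>n=1..N. a (s n))" .
    have "Phi_fun L p N (all_one N) (S s) x * (\<Prod>n=1..N. \<Prod>m=1..<n. pair_den L (x m) (x n))
        = (\<Prod>n=1..N. \<Prod>m=1..<n. (if s m < s n then f_fun L p (x m / x n)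
            else if s m > s n then f_fun L p (x n / x m) else 1) * pair_den L (x m) (x n))"
      unfolding Phi_fun_def prod.distrib
      by (intro arg_cong2[of _ _ _ _ "(*)"] prod.cong refl) (auto simp: elt y)
    also have "\<dots> = (\<Prod>n=1..N. \<Prod>m=1..<n. pair_num L p (s m) (s n) (x m) (x n))"
      using den by (intro prod.cong refl f_fun_mult_den) (auto intro!: x)
    finally have 2: "Phi_fun L p N (all_one N) (S s) x * (\<Prod>n=1..N. \<Prod>m=1..<n. pair_den L (x m) (x n))
        = (\<Prod>n=1..N. \<Prod>m=1..<n. pair_num L p (s m) (s n) (x m) (x n))" .
    have 3: "E_gen L N (all_one N) (S s) x = (\<lambda>v. \<Sum>n=1..N. particle_val L (s n) (x n) v)"
    proof
      fix v
      show "E_gen L N (all_one N) (S s) x v = (\<Sum>n=1..N. particle_val L (s n) (x n) v)"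
        by (cases v) (auto intro!: sum.cong simp: elt y)
    qed
    show "omega_pow L (bform L a (\<lambda>t. \<Sum>n=1..N. weight_sum L (S s n) t))
        * Phi_fun L p N (all_one N) (S s) x * poly_eval (E_gen L N (all_one N) (S s) x) g
        * (\<Prod>n=1..N. \<Prod>m=1..<n. pair_den L (x m) (x n))
      = omega_pow L (\<Sum>n=1..N. a (s n))
        * (\<Prod>n=1..N. \<Prod>m=1..<n. pair_num L p (s m) (s n) (x m) (x n))
        * poly_eval (\<lambda>v. \<Sum>n=1..N. particle_val L (s n) (x n) v) g"
      unfolding 1 3 2[symmetric] by (simp add: mult_ac)
  qed simp
  finally show ?thesis .
qed

section \<open>Nonvanishing of the prefactors and analytic continuation\<close>

lemma R_fun_nonzero:
  assumes "- 2 * pi < Im \<theta>" "Im \<theta> < 0"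
  shows "R_fun L p \<theta> \<noteq> 0"
  using assms by (simp add: R_fun_def R_integral_def)

lemma lambda'_nonzero:
  assumes "L > 0" "0 < p" "p < 1"
  shows "lambda' L p k \<noteq> 0"
proof -
  have "sin (pi * p) > 0"
    using assms by (intro sin_gt_zero) auto
  then show ?thesis using assms by (simp add: lambda'_def)
qed

text \<open>The one-variable identity theorem frees one coordinate at a time from its condition
  \<open>\<theta> n \<in> U n\<close>, so holomorphy in each variable separately suffices.\<close>

lemma separately_entire_zero:
  fixes F :: "('i \<Rightarrow> complex) \<Rightarrow> complex"
  assumes "finite A"
    and hol: "\<And>\<theta> n. (\<lambda>z. F (\<theta>(n := z))) holomorphic_on UNIV"
    and U: "\<And>n. open (U n)" "\<And>n. n \<in> A \<Longrightarrow> U n \<noteq> {}"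
    and zero: "\<And>\<theta>. (\<And>n. n \<in> A \<Longrightarrow> \<theta> n \<in> U n) \<Longrightarrow> F \<theta> = 0"
  shows "F \<theta> = 0"
  using assms(1) U(2) zero
proof (induction A arbitrary: \<theta> rule: finite_induct)
  case (insert n A)
  have "F \<theta> = 0" if \<theta>: "\<And>m. m \<in> A \<Longrightarrow> \<theta> m \<in> U m" for \<theta>
  proof -
    have "F (\<theta>(n := z)) = 0" if "z \<in> U n" for z
      using that \<theta> insert.hyps by (intro insert.prems) auto
    then have "F (\<theta>(n := z)) = 0" for z
      using analytic_continuation_open[of "U n" UNIV "\<lambda>z. F (\<theta>(n := z))" "\<lambda>_. 0" z] insert.prems U(1) hol
      by auto
    from this[of "\<theta> n"] show ?thesis by simp
  qed
  with insert show ?case by blast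
qed simp

lemma holomorphic_particle_val:
  assumes "x holomorphic_on A" "\<And>z. z \<in> A \<Longrightarrow> x z \<noteq> 0"
  shows "(\<lambda>z. particle_val L s (x z) v) holomorphic_on A"
  using assms by (cases v) (auto intro!: holomorphic_intros)

lemma holomorphic_poly_eval:
  assumes "\<And>v. (\<lambda>z. e z v) holomorphic_on A"
  shows "(\<lambda>z. poly_eval (e z) g) holomorphic_on A"
  unfolding poly_eval_def monom_eval_def by (intro holomorphic_intros assms)

lemma holomorphic_J_num:
  assumes "\<And>n. x n holomorphic_on A" "\<And>n z. z \<in> A \<Longrightarrow> x n z \<noteq> 0"
  shows "(\<lambda>z. J_num L p a g N (\<lambda>n. x n z)) holomorphic_on A"
proof -
  have "(\<lambda>z. pair_num L p s s' (x m z) (x n z)) holomorphic_on A" for s s' m n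
    using assms(1) by (cases s s' rule: linorder_cases) (auto simp: pair_num_def pair_den_def intro!: holomorphic_intros)
  then show ?thesis
    unfolding J_num_def
    by (intro holomorphic_intros holomorphic_poly_eval holomorphic_particle_val assms)
qed

text \<open>The \<open>N\<close> strips are disjoint layers of total height
  \<open>2 * pi / L\<close>. For \<open>m < n\<close> the difference thus has imaginary part
  strictly between \<open>- 2 * pi / L\<close> and \<open>0\<close>: inside the strip where
  \<open>R_fun\<close> is an exponential, and off all poles of the pair factors.\<close>

lemma J_num_eq_0_on_strips:
  assumes L: "L \<ge> 2" and p: "0 < p" "p < 1" and a: "a \<in> hdual L"
    and zero: "form_factors L p a g = (\<lambda>_. 0)"
    and \<theta>: "\<And>n. n \<in> {1..N} \<Longrightarrow> 2 * pi / L * ((real n - 1) / N) < Im (\<theta> n) \<and> Im (\<theta> n) < 2 * pi / L * (real n / N)"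
  shows "J_num L p a g N (\<lambda>n. exp (\<theta> n)) = 0"
proof -
  have Im: "- 2 * pi / L < Im (\<theta> m - \<theta> n) \<and> Im (\<theta> m - \<theta> n) < 0" if mn: "n \<in> {1..N}" "m \<in> {1..<n}" for m n
  proof -
    have "2 * pi / L * (real m / N) \<le> 2 * pi / L * ((real n - 1) / N)"
      using mn L by (intro mult_left_mono divide_right_mono) auto
    moreover have "0 \<le> 2 * pi / L * ((real m - 1) / N)"
      using mn by auto
    moreover have "2 * pi / L * (real n / N) \<le> 2 * pi / L * 1"
      using mn by (intro mult_left_mono) auto
    moreover have "m \<in> {1..N}" using mn by auto
    note \<theta>[OF this] \<theta>[OF mn(1)]
    ultimately show ?thesis by simp
  qed
  have neq: "exp (\<theta> m) / exp (\<theta> n) \<notin> {1, omega_pow L 1, omega_pow L (- 1)}"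
    if mn: "n \<in> {1..N}" "m \<in> {1..<n}" for m n
  proof -
    \<comment> \<open>Equality would make the imaginary part an integer multiple of
      \<open>2 * pi / L\<close>, with an integer strictly between \<open>-1\<close> and
      \<open>0\<close>.\<close>
    have "exp (\<theta> m - \<theta> n) \<noteq> omega_pow L (of_int j)" if "j \<in> {-1, 0, 1}" for j
    proof
      assume "exp (\<theta> m - \<theta> n) = omega_pow L (of_int j)"
      then obtain k :: int where "\<theta> m - \<theta> n = 2 * of_real pi * \<i> * of_int j / of_nat L + (of_int (2 * k) * pi) * \<i>"
        unfolding omega_pow_def exp_eq by blast
      from arg_cong[OF this, of Im] have *: "Im (\<theta> m - \<theta> n) = 2 * pi * j / L + 2 * k * pi"
        by simp
      have "(- 2 * pi / L) * L < Im (\<theta> m - \<theta> n) * L" "Im (\<theta> m - \<theta> n) * L < 0 * real L"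
        by (rule mult_strict_right_mono; use Im[OF mn] L in simp)+
      moreover have "Im (\<theta> m - \<theta> n) * L = 2 * pi * (j + k * L)"
        unfolding * using L by (simp add: field_simps)
      ultimately have "(2 * pi) * (-1) < (2 * pi) * (j + k * L)" "(2 * pi) * (j + k * L) < (2 * pi) * 0"
        using L by simp_all
      then have "-1 < real_of_int j + k * L" "real_of_int j + k * L < 0"
        by (simp_all only: mult_less_cancel_left_pos[of "2 * pi"] pi_gt_zero zero_less_mult_iff zero_less_numeral simp_thms)
      then have "real_of_int (-1) < real_of_int (j + k * int L)" "real_of_int (j + k * int L) < real_of_int 0"
        by simp_all
      then show False unfolding of_int_less_iff by linarith
    qed
    from this[of 0] this[of 1] this[of "-1"] show ?thesis
      by (simp add: exp_diff)
  qed
  \<comment> \<open>\<open>form_factors\<close> is zero off extensional arguments, so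
    \<open>\<theta>\<close> is restricted to \<open>{1..N}\<close>.\<close>
  define T where "T = (\<lambda>n\<in>{1..N}. \<theta> n)"
  have T: "T n = \<theta> n" if "n \<in> {1..N}" for n using that by (simp add: T_def)
  have y: "y_pt L (\<lambda>n\<in>{Suc 0..N}. Suc 0) x n (Suc 0) = x n" if "n \<in> {1..N}" for n x
    using that by (simp add: y_pt_def)
  have reg: "regular_point L N (all_one N) T"
    unfolding regular_point_def
  proof (intro ballI)
    fix n m j j'
    assume nm: "n \<in> {1..N}" "m \<in> {1..<n}" and j: "j \<in> {1..all_one N m}" "j' \<in> {1..all_one N n}"
    then have "m \<in> {1..N}" "j = 1" "j' = 1" by auto
    with neq[OF nm] nm show "y_pt L (all_one N) (\<lambda>r. exp (T r)) m j / y_pt L (all_one N) (\<lambda>r. exp (T r)) n j'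
        \<notin> {1, omega_pow L 1, omega_pow L (- 1)}"
      by (simp add: y T)
  qed
  have "form_factors L p a g (N, all_one N, T) = form_factor L p a g N (all_one N) T"
    using L by (auto simp: form_factors_def T_def)
  then have "form_factor L p a g N (all_one N) T = 0"
    using zero by simp
  moreover have "R_kl L p (all_one N m) (all_one N n) (T m - T n) \<noteq> 0" if mn: "n \<in> {1..N}" "m \<in> {1..<n}" for m n
  proof -
    have "2 * pi / L \<le> 2 * pi" using L by (simp add: field_simps)
    then have "- 2 * pi < Im (\<theta> m - \<theta> n)" "Im (\<theta> m - \<theta> n) < 0" using Im[OF mn] by auto
    from R_fun_nonzero[OF this] mn show ?thesis by (simp add: R_kl_def T)
  qed
  moreover have "lambda' L p k \<noteq> 0" for k
    using L p by (intro lambda'_nonzero) auto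
  ultimately have J: "J_fun L p a g N (all_one N) (\<lambda>n. exp (T n)) = 0"
    using reg by (auto simp: form_factor_def)
  have den: "pair_den L (exp (T m)) (exp (T n)) \<noteq> 0" if mn: "n \<in> {1..N}" "m \<in> {1..<n}" for m n
  proof
    assume "pair_den L (exp (T m)) (exp (T n)) = 0"
    moreover have "m \<in> {1..N}" using mn by auto
    ultimately have "exp (\<theta> m) = exp (\<theta> n) \<or> exp (\<theta> m) = omega_pow L 1 * exp (\<theta> n)
       \<or> exp (\<theta> n) = omega_pow L 1 * exp (\<theta> m)"
      using mn by (auto simp: pair_den_def T)
    with neq[OF mn] show False
      by (auto simp: omega_pow_minus field_simps)
  qed
  have "J_num L p a g N (\<lambda>n. exp (T n)) = 0"
    using J_fun_mult_den[OF a, of N "\<lambda>n. exp (T n)" p g] den J by simp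
  also have "J_num L p a g N (\<lambda>n. exp (T n)) = J_num L p a g N (\<lambda>n. exp (\<theta> n))"
    unfolding J_num_def by (intro sum.cong refl arg_cong2[of _ _ _ _ "(*)"] prod.cong arg_cong2[of _ _ _ _ poly_eval] ext)
      (auto simp: T)
  finally show ?thesis .
qed

text \<open>Under \<open>exp\<close> the cleared function becomes entire in each variable, so its
  vanishing spreads from the strips to all nonzero positions, including those where
  \<open>J_fun\<close> has poles.\<close>

lemma J_num_eq_0:
  assumes L: "L \<ge> 2" and p: "0 < p" "p < 1" and a: "a \<in> hdual L"
    and zero: "form_factors L p a g = (\<lambda>_. 0)" and x: "\<And>n. x n \<noteq> 0"
  shows "J_num L p a g N x = 0"
proof -
  define U where "U n = {z. 2 * pi / L * ((real n - 1) / N) < Im z} \<inter> {z. Im z < 2 * pi / L * (real n / N)}" for n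
  have "J_num L p a g N (\<lambda>n. exp (\<theta> n)) = 0" for \<theta>
  proof (rule separately_entire_zero[of "{1..N}" "\<lambda>\<theta>. J_num L p a g N (\<lambda>n. exp (\<theta> n))" U])
    fix \<theta> :: "nat \<Rightarrow> complex" and n
    have "(\<lambda>z. exp ((\<theta>(n := z)) k)) holomorphic_on UNIV" for k
      by (cases "k = n") (auto intro!: holomorphic_intros)
    then show "(\<lambda>z. J_num L p a g N (\<lambda>k. exp ((\<theta>(n := z)) k))) holomorphic_on UNIV"
      by (rule holomorphic_J_num) simp
  next
    show "open (U n)" for n
      unfolding U_def by (intro open_Int open_halfspace_Im_gt open_halfspace_Im_lt)
  next
    fix n assume n: "n \<in> {1..N}"
    have "2 * pi / L * ((real n - 1) / N) < 2 * pi / L * (real n / N)"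
      using n L by (intro mult_strict_left_mono divide_strict_right_mono) auto
    then obtain t where "2 * pi / L * ((real n - 1) / N) < t" "t < 2 * pi / L * (real n / N)"
      using dense by blast
    then have "\<i> * of_real t \<in> U n" by (simp add: U_def)
    then show "U n \<noteq> {}" by blast
  next
    fix \<theta> :: "nat \<Rightarrow> complex" assume "\<And>n. n \<in> {1..N} \<Longrightarrow> \<theta> n \<in> U n"
    then show "J_num L p a g N (\<lambda>n. exp (\<theta> n)) = 0"
      by (intro J_num_eq_0_on_strips[OF L p a zero]) (auto simp: U_def)
  qed simp
  from this[of "\<lambda>n. Ln (x n)"] x show ?thesis by simp
qed

section \<open>Entire functions on the dual Cartan subalgebra\<close>

lemma entire_on_hdual_const: "entire_on_hdual L (\<lambda>_. c)"
  by (auto simp: entire_on_hdual_def)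

lemma entire_on_hdual_coord: "entire_on_hdual L (\<lambda>a. a s)"
  by (auto simp: entire_on_hdual_def intro!: holomorphic_intros
      intro: continuous_on_subset[OF continuous_on_product_coordinates])

lemma entire_on_hdual_mult:
  "entire_on_hdual L F \<Longrightarrow> entire_on_hdual L G \<Longrightarrow> entire_on_hdual L (\<lambda>a. F a * G a)"
  by (auto simp: entire_on_hdual_def intro!: holomorphic_intros continuous_intros)

lemma entire_on_hdual_add:
  "entire_on_hdual L F \<Longrightarrow> entire_on_hdual L G \<Longrightarrow> entire_on_hdual L (\<lambda>a. F a + G a)"
  by (auto simp: entire_on_hdual_def intro!: holomorphic_intros continuous_intros)

lemma entire_on_hdual_diff:
  "entire_on_hdual L F \<Longrightarrow> entire_on_hdual L G \<Longrightarrow> entire_on_hdual L (\<lambda>a. F a - G a)"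
  by (auto simp: entire_on_hdual_def intro!: holomorphic_intros continuous_intros)

lemma entire_on_hdual_sum:
  "(\<And>i. i \<in> I \<Longrightarrow> entire_on_hdual L (F i)) \<Longrightarrow> entire_on_hdual L (\<lambda>a. \<Sum>i\<in>I. F i a)"
  by (auto simp: entire_on_hdual_def intro!: holomorphic_intros continuous_intros)

lemma entire_on_hdual_exp:
  "entire_on_hdual L F \<Longrightarrow> entire_on_hdual L (\<lambda>a. exp (F a))"
  by (auto simp: entire_on_hdual_def intro!: holomorphic_intros continuous_intros)

text \<open>
  Gaussian elimination over a ring of functions: independence of the rows in the limit along a
  ray yields independence off the zero set of one entire function that is nonzero far along the ray.
\<close>

lemma generic_independence:
  fixes A :: "'r \<Rightarrow> 'm \<Rightarrow> (nat \<Rightarrow> complex) \<Rightarrow> complex" and A0 :: "'r \<Rightarrow> 'm \<Rightarrow> complex"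
  assumes "finite M"
    and "\<And>r m. r \<in> R \<Longrightarrow> m \<in> M \<Longrightarrow> entire_on_hdual L (A r m)"
    and "\<And>r m. r \<in> R \<Longrightarrow> m \<in> M \<Longrightarrow> ((\<lambda>\<tau>. A r m (ray \<tau>)) \<longlongrightarrow> A0 r m) \<F>"
    and "\<And>h. (\<And>r. r \<in> R \<Longrightarrow> (\<Sum>m\<in>M. h m * A0 r m) = 0) \<Longrightarrow> \<forall>m\<in>M. h m = 0"
  shows "\<exists>F c. entire_on_hdual L F \<and> ((\<lambda>\<tau>. F (ray \<tau>)) \<longlongrightarrow> c) \<F> \<and> c \<noteq> 0 \<and>
      (\<forall>a h. F a \<noteq> 0 \<longrightarrow> (\<forall>r\<in>R. (\<Sum>m\<in>M. h m * A r m a) = 0) \<longrightarrow> (\<forall>m\<in>M. h m = 0))"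
  using assms
proof (induction M arbitrary: A A0 rule: finite_induct)
  case empty
  then show ?case
    by (intro exI[of _ "\<lambda>_. 1"] exI[of _ 1]) (auto intro: entire_on_hdual_const)
next
  case (insert k M)
  \<comment> \<open>A zero column of limits would make the unit vector at \<open>k\<close> a
    relation, so a pivot row \<open>t\<close> exists.\<close>
  have "\<exists>r\<in>R. A0 r k \<noteq> 0"
  proof (rule ccontr)
    assume "\<not> (\<exists>r\<in>R. A0 r k \<noteq> 0)"
    then have "(\<Sum>m\<in>insert k M. (if m = k then 1 else 0) * A0 r m) = 0" if "r \<in> R" for r
      using that insert.hyps by (intro sum.neutral) auto
    from insert.prems(3)[of "\<lambda>m. if m = k then 1 else 0", OF this] show False by auto
  qed
  then obtain t where t: "t \<in> R" "A0 t k \<noteq> 0" by blast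
  \<comment> \<open>Elimination of column \<open>k\<close> without division, so that all entries
    remain entire.\<close>
  define B where "B = (\<lambda>r m a. A t k a * A r m a - A r k a * A t m a)"
  define B0 where "B0 = (\<lambda>r m. A0 t k * A0 r m - A0 r k * A0 t m)"
  have "\<exists>F c. entire_on_hdual L F \<and> ((\<lambda>\<tau>. F (ray \<tau>)) \<longlongrightarrow> c) \<F> \<and> c \<noteq> 0 \<and>
    (\<forall>a h. F a \<noteq> 0 \<longrightarrow> (\<forall>r\<in>R. (\<Sum>m\<in>M. h m * B r m a) = 0) \<longrightarrow> (\<forall>m\<in>M. h m = 0))"
  proof (rule insert.IH)
    show "entire_on_hdual L (B r m)" if "r \<in> R" "m \<in> M" for r m
      unfolding B_def using that t
      by (intro entire_on_hdual_diff entire_on_hdual_mult insert.prems(1)) auto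
    show "((\<lambda>\<tau>. B r m (ray \<tau>)) \<longlongrightarrow> B0 r m) \<F>" if "r \<in> R" "m \<in> M" for r m
      unfolding B_def B0_def using that t by (intro tendsto_intros insert.prems(2)) auto
    fix h assume h: "\<And>r. r \<in> R \<Longrightarrow> (\<Sum>m\<in>M. h m * B0 r m) = 0"
    \<comment> \<open>The coefficient at \<open>k\<close> is chosen to satisfy the pivot row of
      \<open>A0\<close>; the other rows then follow.\<close>
    define h' where "h' = (\<lambda>m. if m = k then - (\<Sum>m\<in>M. h m * A0 t m) / A0 t k else h m)"
    have "(\<Sum>m\<in>insert k M. h' m * A0 r m) = 0" if "r \<in> R" for r
    proof -
      have "(\<Sum>m\<in>M. h m * B0 r m) = A0 t k * (\<Sum>m\<in>M. h m * A0 r m) - A0 r k * (\<Sum>m\<in>M. h m * A0 t m)"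
        unfolding B0_def by (simp add: sum_distrib_left sum_subtractf[symmetric] algebra_simps)
      then have "A0 t k * (\<Sum>m\<in>M. h m * A0 r m) = A0 r k * (\<Sum>m\<in>M. h m * A0 t m)"
        using h[OF that] by simp
      moreover have "(\<Sum>m\<in>M. h' m * A0 r m) = (\<Sum>m\<in>M. h m * A0 r m)"
        using insert.hyps by (intro sum.cong) (auto simp: h'_def)
      ultimately show ?thesis
        using insert.hyps t by (simp add: h'_def field_simps)
    qed
    then have "\<forall>m\<in>insert k M. h' m = 0" by (rule insert.prems(3))
    then show "\<forall>m\<in>M. h m = 0" using insert.hyps by (metis h'_def insertCI)
  qed
  then obtain F c where F: "entire_on_hdual L F" "((\<lambda>\<tau>. F (ray \<tau>)) \<longlongrightarrow> c) \<F>" "c \<noteq> 0"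
    "\<And>a h. F a \<noteq> 0 \<Longrightarrow> (\<forall>r\<in>R. (\<Sum>m\<in>M. h m * B r m a) = 0) \<Longrightarrow> (\<forall>m\<in>M. h m = 0)"
    by blast
  show ?case
  proof (intro exI conjI allI impI)
    \<comment> \<open>The extra factor keeps the pivot nonzero, so that row \<open>t\<close> forces
      \<open>h k = 0\<close> at the end.\<close>
    show "entire_on_hdual L (\<lambda>a. F a * A t k a)"
      using t by (intro entire_on_hdual_mult F insert.prems(1)) auto
    show "((\<lambda>\<tau>. F (ray \<tau>) * A t k (ray \<tau>)) \<longlongrightarrow> c * A0 t k) \<F>"
      using t by (intro tendsto_mult F insert.prems(2)) auto
    show "c * A0 t k \<noteq> 0" using F t by simp
    fix a h assume nz: "F a * A t k a \<noteq> 0" and h: "\<forall>r\<in>R. (\<Sum>m\<in>insert k M. h m * A r m a) = 0"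
    have h: "h k * A r k a + (\<Sum>m\<in>M. h m * A r m a) = 0" if "r \<in> R" for r
      using h that insert.hyps by simp
    have "(\<Sum>m\<in>M. h m * B r m a) = 0" if "r \<in> R" for r
    proof -
      have "(\<Sum>m\<in>M. h m * B r m a)
          = A t k a * (\<Sum>m\<in>M. h m * A r m a) - A r k a * (\<Sum>m\<in>M. h m * A t m a)"
        unfolding B_def by (simp add: sum_distrib_left sum_subtractf[symmetric] algebra_simps)
      also have "(\<Sum>m\<in>M. h m * A r m a) = - h k * A r k a"
        using h[OF that] by (simp add: eq_neg_iff_add_eq_0 add.commute)
      also have "(\<Sum>m\<in>M. h m * A t m a) = - h k * A t k a"
        using h[OF t(1)] by (simp add: eq_neg_iff_add_eq_0 add.commute)
      finally show ?thesis by simp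
    qed
    with F(4)[of a h] nz have "\<forall>m\<in>M. h m = 0" by auto
    with h[OF t(1)] nz show "\<forall>m\<in>insert k M. h m = 0" by auto
  qed
qed

section \<open>Polynomials vanishing on additive families\<close>

text \<open>With all variables but \<open>w\<close> fixed, a one-variable polynomial vanishes
  identically. Its coefficients are the sums over the monomials with equal exponent at
  \<open>w\<close>, and the induction applies to each.\<close>

lemma monomials_independent:
  fixes \<kappa> :: "'i \<Rightarrow> 'v \<Rightarrow> nat" and h :: "'i \<Rightarrow> complex"
  assumes "finite V" "finite I"
    and "\<And>i j. i \<in> I \<Longrightarrow> j \<in> I \<Longrightarrow> i \<noteq> j \<Longrightarrow> \<exists>v\<in>V. \<kappa> i v \<noteq> \<kappa> j v"
    and "\<And>u. (\<Sum>i\<in>I. h i * (\<Prod>v\<in>V. u v ^ \<kappa> i v)) = 0"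
  shows "\<forall>i\<in>I. h i = 0"
  using assms
proof (induction V arbitrary: I rule: finite_induct)
  case empty
  show ?case
  proof
    fix i assume i: "i \<in> I"
    with empty have "I = {i}" by blast
    with empty show "h i = 0" by simp
  qed
next
  case (insert w V)
  define I' where "I' e = {i\<in>I. \<kappa> i w = e}" for e
  define n where "n = Max (insert 0 ((\<lambda>i. \<kappa> i w) ` I))"
  have n: "\<kappa> i w \<le> n" if "i \<in> I" for i
    unfolding n_def using that insert.prems by (intro Max_ge) auto
  have "(\<Sum>i\<in>I' e. h i * (\<Prod>v\<in>V. u v ^ \<kappa> i v)) = 0" if "e \<le> n" for e u
  proof -
    define c where "c e = (\<Sum>i\<in>I' e. h i * (\<Prod>v\<in>V. u v ^ \<kappa> i v))" for e
    have "(\<Sum>e\<le>n. c e * z ^ e) = 0" for z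
    proof -
      have "(\<Sum>e\<le>n. c e * z ^ e) = (\<Sum>e\<le>n. \<Sum>i\<in>I' e. h i * (\<Prod>v\<in>V. u v ^ \<kappa> i v) * z ^ \<kappa> i w)"
        by (simp add: c_def sum_distrib_right I'_def)
      also have "\<dots> = (\<Sum>i\<in>I. h i * (\<Prod>v\<in>V. u v ^ \<kappa> i v) * z ^ \<kappa> i w)"
        unfolding I'_def using insert.prems n by (intro sum.group) auto
      also have "\<dots> = (\<Sum>i\<in>I. h i * (\<Prod>v\<in>insert w V. (u(w := z)) v ^ \<kappa> i v))"
      proof (intro sum.cong refl)
        fix i
        have "(\<Prod>v\<in>V. (u(w := z)) v ^ \<kappa> i v) = (\<Prod>v\<in>V. u v ^ \<kappa> i v)"
          using insert.hyps by (intro prod.cong) auto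
        then show "h i * (\<Prod>v\<in>V. u v ^ \<kappa> i v) * z ^ \<kappa> i w = h i * (\<Prod>v\<in>insert w V. (u(w := z)) v ^ \<kappa> i v)"
          using insert.hyps by simp
      qed
      finally show ?thesis using insert.prems(3) by simp
    qed
    then have "\<forall>e\<le>n. c e = 0" using polyfun_eq_0[of c n] by blast
    with that show ?thesis by (simp add: c_def)
  qed
  then have "\<forall>i\<in>I' e. h i = 0" if "e \<le> n" for e
    using insert.prems that by (intro insert.IH) (auto simp: I'_def)
  with n show ?case by (auto simp: I'_def)
qed

lemma poly_eval_eq_0_imp_eq_0:
  assumes "\<And>u. poly_eval u g = 0"
  shows "g = 0"
proof -
  let ?K = "Poly_Mapping.keys g" and ?V = "\<Union>m\<in>Poly_Mapping.keys g. Poly_Mapping.keys m"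
  have "\<forall>m\<in>?K. Poly_Mapping.lookup g m = 0"
  proof (rule monomials_independent[where V = ?V and \<kappa> = Poly_Mapping.lookup])
    fix m m' :: "gen \<Rightarrow>\<^sub>0 nat" assume m: "m \<in> ?K" "m' \<in> ?K" "m \<noteq> m'"
    then obtain v where "Poly_Mapping.lookup m v \<noteq> Poly_Mapping.lookup m' v"
      by (meson poly_mapping_eqI)
    moreover from this have "v \<in> Poly_Mapping.keys m \<union> Poly_Mapping.keys m'"
      by (auto simp: in_keys_iff)
    ultimately show "\<exists>v\<in>?V. Poly_Mapping.lookup m v \<noteq> Poly_Mapping.lookup m' v"
      using m by blast
  next
    fix u
    have "poly_eval u g = (\<Sum>m\<in>?K. Poly_Mapping.lookup g m * (\<Prod>v\<in>?V. u v ^ Poly_Mapping.lookup m v))"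
      unfolding poly_eval_def by (intro sum.cong refl arg_cong2[of _ _ _ _ "(*)"] monom_eval_superset) auto
    with assms show "(\<Sum>m\<in>?K. Poly_Mapping.lookup g m * (\<Prod>v\<in>?V. u v ^ Poly_Mapping.lookup m v)) = 0"
      by simp
  qed auto
  then show ?thesis by (intro poly_mapping_eqI) (auto simp: in_keys_iff)
qed

lemma poly_eval_along_line:
  fixes u w :: "gen \<Rightarrow> complex"
  shows "\<exists>q :: complex poly. \<forall>t. poly q t = poly_eval (\<lambda>v. u v + t * w v) g"
  by (intro exI[of _ "\<Sum>m\<in>Poly_Mapping.keys g. smult (Poly_Mapping.lookup g m)
        (\<Prod>v\<in>Poly_Mapping.keys m. [:u v, w v:] ^ Poly_Mapping.lookup m v)"])
    (simp add: poly_eval_def monom_eval_def poly_sum poly_prod)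

text \<open>A polynomial in \<open>t\<close> with infinitely many roots is zero.\<close>

lemma poly_eval_line_eq_0:
  fixes u w :: "gen \<Rightarrow> complex"
  assumes "\<And>n :: nat. poly_eval (\<lambda>v. u v + of_nat n * w v) g = 0"
  shows "poly_eval (\<lambda>v. u v + t * w v) g = 0"
proof -
  obtain q where q: "poly q t = poly_eval (\<lambda>v. u v + t * w v) g" for t
    using poly_eval_along_line by blast
  have "range of_nat \<subseteq> {t. poly q t = 0}"
    using assms by (auto simp: q)
  moreover have "infinite (range (of_nat :: nat \<Rightarrow> complex))"
    by (rule range_inj_infinite) (simp add: inj_on_def)
  ultimately have "q = 0"
    using poly_roots_finite infinite_super by blast
  then show ?thesis using q[of t] by simp
qed

text \<open>Natural multiplicities can be replaced one at a time by complex coefficients.\<close>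

lemma poly_eval_span_eq_0:
  fixes \<phi> :: "'c \<Rightarrow> gen \<Rightarrow> complex"
  assumes "finite C"
    and "\<And>cs. set cs \<subseteq> C \<Longrightarrow> poly_eval (\<lambda>v. u v + (\<Sum>c\<leftarrow>cs. \<phi> c v)) g = 0"
  shows "poly_eval (\<lambda>v. u v + (\<Sum>c\<in>C. t c * \<phi> c v)) g = 0"
  using assms
proof (induction C arbitrary: u rule: finite_induct)
  case empty
  from empty.prems[of "[]"] show ?case by simp
next
  case (insert b C)
  have "poly_eval (\<lambda>v. u v + of_nat n * \<phi> b v + (\<Sum>c\<in>C. t c * \<phi> c v)) g = 0" for n
  proof (rule insert.IH)
    fix cs assume "set cs \<subseteq> C"
    \<comment> \<open>Lists may repeat entries: \<open>n\<close> copies of \<open>b\<close> realise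
      the multiplicity \<open>n\<close>.\<close>
    then have "poly_eval (\<lambda>v. u v + (\<Sum>c\<leftarrow>replicate n b @ cs. \<phi> c v)) g = 0"
      by (intro insert.prems) auto
    then show "poly_eval (\<lambda>v. u v + of_nat n * \<phi> b v + (\<Sum>c\<leftarrow>cs. \<phi> c v)) g = 0"
      by (simp add: sum_list_replicate add.assoc)
  qed
  then have "poly_eval (\<lambda>v. (u v + (\<Sum>c\<in>C. t c * \<phi> c v)) + of_nat n * \<phi> b v) g = 0" for n
    by (simp add: algebra_simps)
  from poly_eval_line_eq_0[OF this, of "t b"] show ?case
    using insert.hyps by (simp add: algebra_simps)
qed

section \<open>Chains of particles\<close>

text \<open>
  A pair \<open>(k, w)\<close> encodes a chain of \<open>k\<close> particles; the base \<open>w\<close> is normalised so that particle \<open>j\<close>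
  sits at \<open>w \<omega>\<^sup>-\<^sup>j\<close>.  Chains of distinct modulus never meet a zero of \<open>pair_num\<close>.
\<close>

definition fusion_chain :: "nat \<Rightarrow> nat \<times> complex \<Rightarrow> (nat \<times> complex) list" where
  "fusion_chain L c = map (\<lambda>j. (j, snd c * omega_pow L (- of_nat j))) [1..<Suc (fst c)]"

definition particles :: "nat \<Rightarrow> (nat \<times> complex) list \<Rightarrow> (nat \<times> complex) list" where
  "particles L cs = concat (map (fusion_chain L) cs)"

definition admissible :: "nat \<Rightarrow> (nat \<times> complex) list \<Rightarrow> bool" where
  "admissible L cs \<longleftrightarrow>
     (\<forall>c\<in>set cs. fst c \<in> {1..<L} \<and> snd c \<noteq> 0) \<and> distinct (map (\<lambda>c. norm (snd c)) cs)"

text \<open>The weights run through \<open>1, ..., k\<close> along each chain; by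
  \<open>min_index_le_of_nonzero\<close> this is the pointwise least choice. Particles are counted
  from \<open>1\<close>, list entries from \<open>0\<close>.\<close>

definition min_index :: "(nat \<times> complex) list \<Rightarrow> nat \<Rightarrow> nat" where
  "min_index xs = (\<lambda>n\<in>{1..length xs}. fst (xs ! (n - 1)))"

text \<open>The junk value \<open>1\<close> keeps all positions nonzero.\<close>

definition chain_pos :: "(nat \<times> complex) list \<Rightarrow> nat \<Rightarrow> complex" where
  "chain_pos xs n = (if n \<in> {1..length xs} then snd (xs ! (n - 1)) else 1)"

lemma in_set_fusion_chain:
  "c' \<in> set (fusion_chain L c) \<Longrightarrow> fst c' \<in> {1..fst c} \<and> norm (snd c') = norm (snd c)"
  by (auto simp: fusion_chain_def norm_mult)

lemma in_set_particles:
  "c' \<in> set (particles L cs) \<Longrightarrow> \<exists>c\<in>set cs. fst c' \<in> {1..fst c} \<and> norm (snd c') = norm (snd c)"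
  unfolding particles_def using in_set_fusion_chain[of c' L] by (auto simp del: atLeastAtMost_iff split_paired_All)

text \<open>Every factor has the form \<open>u - c * v\<close> with \<open>norm c = 1\<close>, so it
  can vanish only at equal moduli.\<close>

lemma pair_num_nonzero_norm:
  assumes "norm x \<noteq> norm y"
  shows "pair_num L p s s' x y \<noteq> 0"
proof -
  have "u - c * v \<noteq> 0" if "norm c = 1" "norm u \<noteq> norm v" for c u v :: complex
    using that by (auto simp: norm_mult)
  moreover from this[of 1] have "x - y \<noteq> 0" using assms by auto
  ultimately show ?thesis
    using assms assms[symmetric] by (auto simp: pair_num_def pair_den_def)
qed

text \<open>The ratio of the positions is \<omega> to the power \<open>d = j - i\<close>.
  Irrationality of \<open>p\<close> excludes the zeros of two factors, and
  \<open>0 < d + 1 < L\<close> those of the third.\<close>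

lemma pair_num_chain_nonzero:
  assumes "L > 0" "p \<notin> \<rat>" "w \<noteq> 0" "1 \<le> i" "i < j" "j < L"
  shows "pair_num L p i j (w * omega_pow L (- of_nat i)) (w * omega_pow L (- of_nat j)) \<noteq> 0"
proof -
  define y where "y = w * omega_pow L (- of_nat j)"
  define d where "d = j - i"
  have d: "0 < d" "Suc d < L" using assms by (auto simp: d_def)
  have "w * omega_pow L (- of_nat i) = omega_pow L (of_nat d) * y"
    using assms by (simp add: y_def d_def omega_pow_add[symmetric] of_nat_diff mult_ac)
  moreover have "y \<noteq> 0" using assms by (simp add: y_def)
  moreover have "y - omega_pow L 1 * (omega_pow L (of_nat d) * y) = (1 - omega_pow L (of_nat (Suc d))) * y"
    by (simp add: omega_pow_add algebra_simps)
  moreover have "omega_pow L (of_nat (Suc d)) \<noteq> 1"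
    using d by (intro omega_pow_of_nat_neq_1) auto
  moreover have "omega_pow L (of_nat d) * y - c * y = (omega_pow L (of_nat d) - c) * y" for c
    by (simp add: algebra_simps)
  ultimately show ?thesis
    using assms omega_pow_of_nat_neq_irrational[of L p d] unfolding y_def[symmetric]
    by (simp add: pair_num_def del: of_nat_Suc)
qed

text \<open>\<open>sorted_wrt\<close> states the condition for all pairs in list order. Pairs within
  a chain fall under \<open>pair_num_chain_nonzero\<close>; pairs from different chains have
  distinct moduli.\<close>

lemma sorted_wrt_particles:
  assumes "L > 0" "p \<notin> \<rat>" "admissible L cs"
  shows "sorted_wrt (\<lambda>c c'. pair_num L p (fst c) (fst c') (snd c) (snd c') \<noteq> 0) (particles L cs)"
  using assms(3)
proof (induction cs)
  case (Cons c cs)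
  have c: "fst c \<in> {1..<L}" "snd c \<noteq> 0" "admissible L cs" "norm (snd c) \<notin> (\<lambda>c. norm (snd c)) ` set cs"
    using Cons.prems by (auto simp: admissible_def)
  have "sorted_wrt (\<lambda>i j. pair_num L p i j (snd c * omega_pow L (- of_nat i)) (snd c * omega_pow L (- of_nat j)) \<noteq> 0)
      [1..<Suc (fst c)]"
  proof (rule sorted_wrt_mono_rel[OF _ sorted_wrt_upt])
    fix i j assume "i \<in> set [1..<Suc (fst c)]" "j \<in> set [1..<Suc (fst c)]" "i < j"
    then show "pair_num L p i j (snd c * omega_pow L (- of_nat i)) (snd c * omega_pow L (- of_nat j)) \<noteq> 0"
      using c assms(1,2) by (intro pair_num_chain_nonzero) auto
  qed
  then have "sorted_wrt (\<lambda>c c'. pair_num L p (fst c) (fst c') (snd c) (snd c') \<noteq> 0) (fusion_chain L c)"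
    by (simp only: fusion_chain_def sorted_wrt_map fst_conv snd_conv)
  moreover have "pair_num L p (fst b) (fst b') (snd b) (snd b') \<noteq> 0"
    if "b \<in> set (fusion_chain L c)" "b' \<in> set (particles L cs)" for b b'
    using in_set_fusion_chain[OF that(1)] in_set_particles[OF that(2)] c(4)
    by (intro pair_num_nonzero_norm) (metis image_eqI)
  ultimately show ?case
    using Cons.IH[OF c(3)] by (auto simp: particles_def sorted_wrt_append)
qed (simp add: particles_def)

text \<open>The first alternative admits the start of a new chain; the second places neighbours at a
  pole of \<open>f_fun\<close>.\<close>

definition linked :: "nat \<Rightarrow> nat \<times> complex \<Rightarrow> nat \<times> complex \<Rightarrow> bool" where
  "linked L c c' \<longleftrightarrow> fst c' = 1 \<or> (fst c' = Suc (fst c) \<and> snd c = omega_pow L 1 * snd c')"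

lemma chain_linked: "Suc n < length (fusion_chain L c) \<Longrightarrow> linked L (fusion_chain L c ! n) (fusion_chain L c ! Suc n)"
  by (simp add: fusion_chain_def linked_def omega_pow_add[symmetric] del: upt_Suc)

lemma chain_hd: "0 < length (fusion_chain L c) \<Longrightarrow> fst (fusion_chain L c ! 0) = 1"
  by (simp add: fusion_chain_def del: upt_Suc)

lemma particles_hd: "0 < length (particles L cs) \<Longrightarrow> fst (particles L cs ! 0) = 1"
proof (induction cs)
  case (Cons c cs)
  then show ?case
    by (cases "fusion_chain L c = []") (auto simp: particles_def nth_append chain_hd)
qed (simp add: particles_def)

lemma particles_linked:
  "Suc n < length (particles L cs) \<Longrightarrow> linked L (particles L cs ! n) (particles L cs ! Suc n)"
proof (induction cs arbitrary: n)
  case (Cons c cs)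
  have eq: "particles L (c # cs) = fusion_chain L c @ particles L cs" by (simp add: particles_def)
  consider "Suc n < length (fusion_chain L c)" | "Suc n = length (fusion_chain L c)" | "length (fusion_chain L c) \<le> n" by linarith
  then show ?case
  proof cases
    case 1
    then show ?thesis by (simp add: eq nth_append chain_linked)
  next
    case 2
    \<comment> \<open>At the boundary between chains the next weight index is \<open>1\<close>, the
      first alternative of \<open>linked\<close>.\<close>
    moreover from this have "fst (particles L cs ! 0) = 1"
      using Cons.prems by (intro particles_hd) (simp add: eq)
    ultimately show ?thesis by (simp add: eq nth_append linked_def)
  next
    case 3
    then have "Suc (n - length (fusion_chain L c)) < length (particles L cs)"
      using Cons.prems by (simp add: eq)
    from Cons.IH[OF this] 3 show ?thesis by (simp add: eq nth_append Suc_diff_le)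
  qed
qed (simp add: particles_def)

text \<open>
  Within a chain, \<open>x\<^sub>n = \<omega> x\<^bsub>n+1\<^esub>\<close> kills every factor \<open>pair_num\<close> except those with \<open>s\<^sub>n < s\<^bsub>n+1\<^esub>\<close>.
\<close>

lemma min_index_le_of_nonzero:
  assumes xs: "xs = particles L cs"
    and nz: "(\<Prod>n=1..length xs. \<Prod>m=1..<n. pair_num L p (s m) (s n) (chain_pos xs m) (chain_pos xs n)) \<noteq> 0"
    and s: "s \<in> {1..length xs} \<rightarrow> {1..L}" and n: "n \<in> {1..length xs}"
  shows "min_index xs n \<le> s n"
proof -
  have "Suc 0 \<le> n" using n by simp
  then show ?thesis using n
  proof (induction n rule: dec_induct)
    case base
    moreover have "fst (xs ! 0) = 1"
      using base unfolding xs by (intro particles_hd) auto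
    moreover have "1 \<le> s 1" using s base by auto
    ultimately show ?case by (simp add: min_index_def)
  next
    case (step n)
    have n: "n \<in> {1..length xs}" using step by auto
    have "linked L (xs ! (n - 1)) (xs ! Suc (n - 1))"
      unfolding xs using step by (intro particles_linked) (auto simp: xs)
    then consider "min_index xs (Suc n) = 1"
      | "min_index xs (Suc n) = Suc (min_index xs n)" "chain_pos xs n = omega_pow L 1 * chain_pos xs (Suc n)"
      using step n by (auto simp: linked_def min_index_def chain_pos_def)
    then show ?case
    proof cases
      case 1
      moreover have "1 \<le> s (Suc n)" using s step.prems by (auto simp: Pi_def)
      ultimately show ?thesis by simp
    next
      case 2
      have "pair_num L p (s n) (s (Suc n)) (chain_pos xs n) (chain_pos xs (Suc n)) \<noteq> 0"
        using nz step.prems step.hyps by (simp add: prod_zero_iff Ball_def)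
      then have "s n < s (Suc n)"
        using 2 by (auto simp: pair_num_def pair_den_def split: if_splits)
      with 2 step.IH[OF n] show ?thesis by simp
    qed
  qed
qed

section \<open>Values of the generators on chains\<close>

fun chain_val :: "nat \<Rightarrow> nat \<times> complex \<Rightarrow> gen \<Rightarrow> complex" where
  "chain_val L c (Gen i m) =
     (if i = fst c then omega_pow L (- ((of_nat L + 1) / 2) * of_nat m) * snd c ^ m else 0)"
| "chain_val L c (GenBar i m) =
     (if i + fst c = L then - omega_pow L ((of_nat L + 1) / 2 * of_nat m) * snd c powi (- int m) else 0)"

text \<open>Neighbours in a chain cancel, so only the generators matching its length see the chain.\<close>

lemma sum_chain_particle_val:
  assumes c: "fst c \<in> {1..<L}" and v: "v \<in> gens L"
  shows "(\<Sum>b\<leftarrow>fusion_chain L c. particle_val L (fst b) (snd b) v) = chain_val L c v"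
proof -
  obtain k w where kw: "c = (k, w)" by (cases c)
  have "(\<Sum>b\<leftarrow>fusion_chain L c. particle_val L (fst b) (snd b) v)
      = (\<Sum>j=1..k. particle_val L j (w * omega_pow L (- of_nat j)) v)"
    by (simp add: fusion_chain_def kw comp_def interv_sum_list_conv_sum_set_nat atLeastLessThanSuc_atLeastAtMost del: upt_Suc)
  also have "\<dots> = chain_val L c v"
  proof (cases v)
    case (Gen i m)
    then have i: "i \<in> {1..<L}" using v by (auto simp: gens_def)
    have "particle_val L j (w * omega_pow L (- of_nat j)) v
        = ((if j = i then 1 else 0) - (if j = i + 1 then 1 else 0))
          * (omega_pow L (- ((of_nat L + 1) / 2) * of_nat m) * w ^ m)" if "j \<in> {1..k}" for j
    proof -
      \<comment> \<open>The offset of the position cancels the dependence of the phase on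
        \<open>j\<close>, so only the integer coefficients remain to be summed.\<close>
      have "omega_pow L (- ((of_nat L + 1 - 2 * of_nat j) / 2) * of_nat m) * omega_pow L (- of_nat j) ^ m
          = omega_pow L (- ((of_nat L + 1) / 2) * of_nat m)"
        unfolding omega_pow_power omega_pow_add[symmetric]
        by (rule arg_cong[of _ _ "omega_pow L"]) (simp add: field_simps)
      then show ?thesis
        using that c i by (simp add: Gen kw bform_simple_root_weight power_mult_distrib mult_ac)
    qed
    then have "(\<Sum>j=1..k. particle_val L j (w * omega_pow L (- of_nat j)) v)
        = (\<Sum>j=1..k. (if j = i then 1 else 0) - (if j = i + 1 then 1 else 0))
          * (omega_pow L (- ((of_nat L + 1) / 2) * of_nat m) * w ^ m)"
      by (simp only: sum_distrib_right cong: sum.cong)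
    \<comment> \<open>The \<open>1\<close> at \<open>j = i\<close> is cancelled at
      \<open>j = i + 1\<close> unless the chain ends at \<open>i\<close>.\<close>
    also have "(\<Sum>j=1..k. (if j = i then 1 else 0) - (if j = i + 1 then 1 else 0))
        = (if i = k then 1 else 0 :: complex)"
      using i c by (auto simp: sum_subtractf kw)
    finally show ?thesis by (simp add: Gen kw)
  next
    case (GenBar i m)
    then have i: "i \<in> {1..<L}" using v by (auto simp: gens_def)
    have "particle_val L j (w * omega_pow L (- of_nat j)) v
        = ((if j = L + 1 - i then 1 else 0) - (if j = L - i then 1 else 0))
          * (omega_pow L ((of_nat L + 1) / 2 * of_nat m) * w powi (- int m))" if "j \<in> {1..k}" for j
    proof -
      have *: "omega_pow L ((of_nat L + 1 - 2 * of_nat j) / 2 * of_nat m) * omega_pow L (- of_nat j) powi (- int m)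
          = omega_pow L ((of_nat L + 1) / 2 * of_nat m)"
        unfolding omega_pow_powi omega_pow_add[symmetric]
        by (rule arg_cong[of _ _ "omega_pow L"]) (simp add: field_simps)
      have "bform L (simple_root L i) (weight L (L + 1 - j))
          = (if j = L + 1 - i then 1 else 0) - (if j = L - i then 1 else 0)"
        using that c i by (subst bform_simple_root_weight) (auto simp: kw)
      then have "particle_val L j (w * omega_pow L (- of_nat j)) v
        = ((if j = L + 1 - i then 1 else 0) - (if j = L - i then 1 else 0))
          * (omega_pow L ((of_nat L + 1 - 2 * of_nat j) / 2 * of_nat m) * omega_pow L (- of_nat j) powi (- int m)) * w powi (- int m)"
        unfolding GenBar particle_val.simps power_int_mult_distrib by (simp only: mult_ac)
      then show ?thesis unfolding * by (simp only: mult.assoc)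
    qed
    then have "(\<Sum>j=1..k. particle_val L j (w * omega_pow L (- of_nat j)) v)
        = (\<Sum>j=1..k. (if j = L + 1 - i then 1 else 0) - (if j = L - i then 1 else 0))
          * (omega_pow L ((of_nat L + 1) / 2 * of_nat m) * w powi (- int m))"
      by (simp only: sum_distrib_right cong: sum.cong)
    \<comment> \<open>Weights are reversed here, so the \<open>-1\<close> comes first, at
      \<open>j = L - i\<close>, and survives when the chain ends there.\<close>
    also have "(\<Sum>j=1..k. (if j = L + 1 - i then 1 else 0) - (if j = L - i then 1 else 0))
        = (if i + k = L then -1 else 0 :: complex)"
      using i c by (auto simp: sum_subtractf kw)
    finally show ?thesis by (simp add: GenBar kw)
  qed
  finally show ?thesis .
qed

lemma sum_particle_val:
  assumes cs: "admissible L cs" and v: "v \<in> gens L" and xs: "xs = particles L cs"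
  shows "(\<Sum>n=1..length xs. particle_val L (min_index xs n) (chain_pos xs n) v) = (\<Sum>c\<leftarrow>cs. chain_val L c v)"
proof -
  have "(\<Sum>n=1..length xs. particle_val L (min_index xs n) (chain_pos xs n) v)
      = (\<Sum>n=1..length xs. particle_val L (fst (xs ! (n - 1))) (snd (xs ! (n - 1))) v)"
    by (intro sum.cong) (auto simp: min_index_def chain_pos_def)
  also have "\<dots> = (\<Sum>n<length xs. particle_val L (fst (xs ! n)) (snd (xs ! n)) v)"
    by (rule sum.reindex_bij_witness[of _ Suc "\<lambda>n. n - 1"]) auto
  also have "\<dots> = (\<Sum>b\<leftarrow>xs. particle_val L (fst b) (snd b) v)"
    by (simp add: sum_list_sum_nth atLeast0LessThan)
  also have "\<dots> = (\<Sum>c\<leftarrow>cs. \<Sum>b\<leftarrow>fusion_chain L c. particle_val L (fst b) (snd b) v)"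
    unfolding xs particles_def by (induction cs) auto
  also have "\<dots> = (\<Sum>c\<leftarrow>cs. chain_val L c v)"
    using cs v by (intro arg_cong[of _ _ sum_list] map_cong refl sum_chain_particle_val) (auto simp: admissible_def)
  finally show ?thesis .
qed

lemma min_index_in_PiE:
  assumes "admissible L cs" "xs = particles L cs"
  shows "min_index xs \<in> {1..length xs} \<rightarrow>\<^sub>E {1..L}"
proof -
  have "fst (xs ! (n - 1)) \<in> {1..L}" if "n \<in> {1..length xs}" for n
  proof -
    have "xs ! (n - 1) \<in> set xs" using that by auto
    from in_set_particles[OF this[unfolded assms(2)]] assms show ?thesis
      by (force simp: admissible_def)
  qed
  then show ?thesis by (auto simp: min_index_def)
qed

lemma chain_pos_nonzero:
  assumes "admissible L cs"
  shows "chain_pos (particles L cs) n \<noteq> 0"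
proof -
  have "snd (particles L cs ! (n - 1)) \<noteq> 0" if "n \<in> {1..length (particles L cs)}"
  proof -
    have "particles L cs ! (n - 1) \<in> set (particles L cs)" using that by auto
    from in_set_particles[OF this] assms show ?thesis
      by (force simp: admissible_def)
  qed
  then show ?thesis by (auto simp: chain_pos_def)
qed

lemma prod_pair_num_min_index_nonzero:
  assumes "L > 0" "p \<notin> \<rat>" "admissible L cs" "xs = particles L cs"
  shows "(\<Prod>n=1..length xs. \<Prod>m=1..<n. pair_num L p (min_index xs m) (min_index xs n) (chain_pos xs m) (chain_pos xs n)) \<noteq> 0"
proof -
  have "pair_num L p (min_index xs m) (min_index xs n) (chain_pos xs m) (chain_pos xs n) \<noteq> 0"
    if "n \<in> {1..length xs}" "m \<in> {1..<n}" for m n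
    using sorted_wrt_particles[OF assms(1-3)] that
    unfolding assms(4) sorted_wrt_iff_nth_less by (auto simp: min_index_def chain_pos_def)
  then show ?thesis by (auto simp: prod_zero_iff)
qed

section \<open>Continuity in the bases and separation by Fourier inversion\<close>

lemma tendsto_sum_list:
  fixes f :: "'a \<Rightarrow> 'b \<Rightarrow> 'c :: topological_monoid_add"
  assumes "\<And>x. x \<in> set xs \<Longrightarrow> (f x \<longlongrightarrow> l x) F"
  shows "((\<lambda>z. \<Sum>x\<leftarrow>xs. f x z) \<longlongrightarrow> (\<Sum>x\<leftarrow>xs. l x)) F"
  using assms by (induction xs) (auto intro!: tendsto_intros)

lemma tendsto_poly_eval:
  assumes "\<And>v. ((\<lambda>z. e z v) \<longlongrightarrow> l v) F"
  shows "((\<lambda>z. poly_eval (e z) g) \<longlongrightarrow> poly_eval l g) F"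
  unfolding poly_eval_def monom_eval_def by (intro tendsto_intros assms)

lemma tendsto_chain_val:
  assumes "(w \<longlongrightarrow> l) F" "l \<noteq> 0"
  shows "((\<lambda>z. chain_val L (k, w z) v) \<longlongrightarrow> chain_val L (k, l) v) F"
  using assms by (cases v) (auto intro!: tendsto_intros tendsto_power_int)

text \<open>Chains of equal modulus are limits of admissible ones.\<close>

lemma poly_eval_unit_chains:
  assumes adm: "\<And>cs. admissible L cs \<Longrightarrow> poly_eval (\<lambda>v. \<Sum>c\<leftarrow>cs. chain_val L c v) g = 0"
    and cs: "\<And>c. c \<in> set cs \<Longrightarrow> fst c \<in> {1..<L} \<and> norm (snd c) = 1"
  shows "poly_eval (\<lambda>v. \<Sum>c\<leftarrow>cs. chain_val L c v) g = 0"
proof -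
  \<comment> \<open>The factors \<open>1 + \<epsilon> * r\<close> separate the moduli for
    \<open>\<epsilon> > 0\<close> and tend to \<open>1\<close>.\<close>
  define w where "w r \<epsilon> = snd (cs ! r) * of_real (1 + \<epsilon> * real r)" for r \<epsilon>
  define cs' where "cs' \<epsilon> = map (\<lambda>r. (fst (cs ! r), w r \<epsilon>)) [0..<length cs]" for \<epsilon>
  have lim: "((\<lambda>\<epsilon>. poly_eval (\<lambda>v. \<Sum>r\<leftarrow>[0..<length cs]. chain_val L (fst (cs ! r), w r \<epsilon>) v) g) \<longlongrightarrow>
      poly_eval (\<lambda>v. \<Sum>r\<leftarrow>[0..<length cs]. chain_val L (fst (cs ! r), snd (cs ! r)) v) g) (at_right 0)"
  proof (intro tendsto_poly_eval tendsto_sum_list tendsto_chain_val)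
    fix r assume "r \<in> set [0..<length cs]"
    then have "cs ! r \<in> set cs" by simp
    with cs[of "cs ! r"] show "snd (cs ! r) \<noteq> 0" by auto
    have "(w r \<longlongrightarrow> snd (cs ! r) * of_real (1 + 0 * real r)) (at_right 0)"
      unfolding w_def by (intro tendsto_intros)
    then show "(w r \<longlongrightarrow> snd (cs ! r)) (at_right 0)" by simp
  qed
  have "poly_eval (\<lambda>v. \<Sum>r\<leftarrow>[0..<length cs]. chain_val L (fst (cs ! r), w r \<epsilon>) v) g = 0" if "\<epsilon> > 0" for \<epsilon>
  proof -
    have norm: "norm (w r \<epsilon>) = 1 + \<epsilon> * real r" if "r < length cs" for r
      using cs[of "cs ! r"] that \<open>\<epsilon> > 0\<close> unfolding w_def norm_mult norm_of_real by simp
    have "admissible L (cs' \<epsilon>)"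
      unfolding admissible_def
    proof
      have "w r \<epsilon> \<noteq> 0" if "r < length cs" for r
      proof -
        have "0 < norm (w r \<epsilon>)" unfolding norm[OF that] using \<open>\<epsilon> > 0\<close> by (simp add: add_pos_nonneg)
        then show ?thesis by simp
      qed
      with cs show "\<forall>c\<in>set (cs' \<epsilon>). fst c \<in> {1..<L} \<and> snd c \<noteq> 0"
        by (auto simp: cs'_def)
      have "inj_on (\<lambda>r. norm (w r \<epsilon>)) {0..<length cs}"
        using that by (auto intro!: inj_onI simp: norm)
      then show "distinct (map (\<lambda>c. norm (snd c)) (cs' \<epsilon>))"
        by (simp add: cs'_def distinct_map comp_def)
    qed
    from adm[OF this] show ?thesis by (simp add: cs'_def comp_def)
  qed
  then have "\<forall>\<^sub>F \<epsilon> in at_right 0. poly_eval (\<lambda>v. \<Sum>r\<leftarrow>[0..<length cs]. chain_val L (fst (cs ! r), w r \<epsilon>) v) g = 0"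
    by (auto simp: eventually_at_right_field intro: exI[of _ 1])
  from tendsto_unique[OF _ lim tendsto_eventually[OF this]]
  have "poly_eval (\<lambda>v. \<Sum>r\<leftarrow>[0..<length cs]. chain_val L (cs ! r) v) g = 0"
    by simp
  moreover have "(\<Sum>r\<leftarrow>[0..<length cs]. chain_val L (cs ! r) v) = (\<Sum>c\<leftarrow>cs. chain_val L c v)" for v
    by (simp add: sum_list_sum_nth)
  ultimately show ?thesis by simp
qed

text \<open>
  \<open>coord L k e\<close> is the generator that reads off the \<open>e\<close>-th power sum over the chains of length \<open>k\<close>; the case
  \<open>e = 0\<close> is junk.
\<close>

definition coord :: "nat \<Rightarrow> nat \<Rightarrow> int \<Rightarrow> gen" where
  "coord L k e = (if e > 0 then Gen k (nat e) else GenBar (L - k) (nat (- e)))"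

text \<open>A signed exponent merges both families of generators: the sign of the barred values
  becomes \<open>sgn e\<close>, and the two phases become one formula.\<close>

lemma chain_val_coord:
  assumes "c = (k', w)" "k \<in> {1..<L}" "k' \<in> {1..<L}" "e \<noteq> 0"
  shows "chain_val L c (coord L k e)
    = (if k = k' then of_int (sgn e) * omega_pow L (- ((of_nat L + 1) / 2) * of_int e) * w powi e else 0)"
proof (cases "e > 0")
  case True
  moreover from this have "w ^ nat e = w powi e" by (simp add: power_int_def)
  ultimately show ?thesis using assms by (simp add: coord_def)
next
  case False
  moreover have "L - k + k' = L \<longleftrightarrow> k = k'" using assms by auto
  ultimately show ?thesis using assms by (simp add: coord_def mult_ac)
qed

text \<open>A geometric sum; the bound on \<open>d\<close> excludes nonzero multiples of
  \<open>T\<close>. Here \<open>omega_pow\<close> is used with \<open>T\<close> in place of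
  \<open>L\<close>.\<close>

lemma sum_roots_of_unity:
  assumes "T > 0" "\<bar>d\<bar> < int T"
  shows "(\<Sum>j<T. omega_pow T (of_nat j) powi d) = (if d = 0 then of_nat T else 0)"
proof (cases "d = 0")
  case False
  have "omega_pow T (of_int d) \<noteq> 1"
  proof
    assume "omega_pow T (of_int d) = 1"
    with omega_pow_of_real_eqD[of T "of_int d" 0] assms obtain k :: int where "of_int d = k * real T"
      by auto
    then have "d = k * int T"
      by (metis of_int_eq_iff of_int_mult of_int_of_nat_eq)
    then have "int T dvd d" by simp
    with assms False show False using zdvd_not_zless[of "\<bar>d\<bar>" "int T"] by simp
  qed
  moreover have "omega_pow T (of_int d) ^ T = 1"
  proof -
    have "omega_pow T (of_int d) ^ T = exp (2 * of_real pi * \<i> * of_int d)"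
      unfolding omega_pow_power unfolding omega_pow_def
      by (rule arg_cong[of _ _ exp]) (use assms in \<open>simp add: divide_simps\<close>)
    also have "\<dots> = 1" by (subst exp_eq_1) (intro conjI exI[of _ d]; simp)
    finally show ?thesis .
  qed
  ultimately have "(\<Sum>j<T. omega_pow T (of_int d) ^ j) = 0"
    by (subst sum_gp_strict) simp
  with False show ?thesis
    by (simp only: omega_pow_power omega_pow_powi mult.commute if_False)
qed simp

lemma chains_separate_polynomials:
  assumes adm: "\<And>cs. admissible L cs \<Longrightarrow> poly_eval (\<lambda>v. \<Sum>c\<leftarrow>cs. chain_val L c v) g = 0"
    and g: "g \<in> algebra_AA L"
  shows "g = 0"
proof (rule poly_eval_eq_0_imp_eq_0)
  \<comment> \<open>By discrete Fourier inversion, chains based at roots of unity span all values \<open>u\<close> of the generators.\<close>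
  fix u
  define V where "V = (\<Union>m\<in>Poly_Mapping.keys g. Poly_Mapping.keys m)"
  have V: "finite V" "V \<subseteq> gens L" using g by (auto simp: V_def algebra_AA_def)
  define ord where "ord v = (case v of Gen i m \<Rightarrow> m | GenBar i m \<Rightarrow> m)" for v
  define D where "D = Max (insert 0 (ord ` V))"
  have D: "ord v \<le> D" if "v \<in> V" for v
    unfolding D_def using that V by (intro Max_ge) auto
  \<comment> \<open>Differences of exponents in \<open>{- D..D}\<close> stay below \<open>T\<close>
    in absolute value, as orthogonality requires.\<close>
  define T where "T = 2 * D + 1"
  define \<zeta> where "\<zeta> j = omega_pow T (of_nat j)" for j
  define K where "K e = of_int (sgn e) * omega_pow L (- ((of_nat L + 1) / 2) * of_int e)" for e
  define E where "E = {- int D..int D}"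
  \<comment> \<open>The inverse discrete Fourier transform for each chain length. The junk term
    \<open>e = 0\<close> drops out, since \<open>K 0 = 0\<close> and division by zero gives
    zero.\<close>
  define t where "t = (\<lambda>(k, j). (\<Sum>e\<in>E. u (coord L k e) / K e * \<zeta> j powi (- e)) / of_nat T)"
  define C where "C = {1..<L} \<times> {..<T}"
  have val: "(\<Sum>(k, j)\<in>C. t (k, j) * chain_val L (k, \<zeta> j) (coord L k0 e0)) = u (coord L k0 e0)"
    if k0: "k0 \<in> {1..<L}" and e0: "e0 \<in> E" "e0 \<noteq> 0" for k0 e0
  proof -
    have "(\<Sum>(k, j)\<in>C. t (k, j) * chain_val L (k, \<zeta> j) (coord L k0 e0))
        = (\<Sum>k\<in>{1..<L}. \<Sum>j<T. t (k, j) * chain_val L (k, \<zeta> j) (coord L k0 e0))"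
      by (simp add: C_def sum.cartesian_product)
    also have "\<dots> = (\<Sum>k\<in>{1..<L}. if k = k0 then \<Sum>j<T. t (k0, j) * (K e0 * \<zeta> j powi e0) else 0)"
      using k0 e0 by (intro sum.cong refl) (auto simp: chain_val_coord K_def)
    also have "\<dots> = (\<Sum>j<T. t (k0, j) * (K e0 * \<zeta> j powi e0))"
      using k0 by simp
    also have "\<dots> = (\<Sum>j<T. \<Sum>e\<in>E. K e0 / of_nat T * (u (coord L k0 e) / K e) * \<zeta> j powi (e0 - e))"
    proof (rule sum.cong)
      fix j
      have "\<zeta> j powi (e0 - e) = \<zeta> j powi (- e) * \<zeta> j powi e0" for e
        by (simp add: \<zeta>_def power_int_diff power_int_minus divide_inverse mult.commute)
      then show "t (k0, j) * (K e0 * \<zeta> j powi e0)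
          = (\<Sum>e\<in>E. K e0 / of_nat T * (u (coord L k0 e) / K e) * \<zeta> j powi (e0 - e))"
        by (simp only: t_def prod.case sum_distrib_left sum_distrib_right divide_inverse mult_ac)
    qed simp
    also have "\<dots> = (\<Sum>e\<in>E. K e0 / of_nat T * (u (coord L k0 e) / K e) * (\<Sum>j<T. \<zeta> j powi (e0 - e)))"
      by (subst sum.swap) (simp add: sum_distrib_left)
    also have "\<dots> = (\<Sum>e\<in>E. if e = e0 then u (coord L k0 e0) else 0)"
    proof (intro sum.cong refl)
      fix e assume e: "e \<in> E"
      have "(\<Sum>j<T. \<zeta> j powi (e0 - e)) = (if e0 - e = 0 then of_nat T else 0)"
        unfolding \<zeta>_def using e e0 by (intro sum_roots_of_unity) (auto simp: E_def T_def)
      moreover have "K e0 \<noteq> 0" using e0 by (simp add: K_def sgn_if)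
      moreover have "(of_nat T :: complex) \<noteq> 0" by (subst of_nat_eq_0_iff) (simp add: T_def)
      ultimately show "K e0 / of_nat T * (u (coord L k0 e) / K e) * (\<Sum>j<T. \<zeta> j powi (e0 - e))
          = (if e = e0 then u (coord L k0 e0) else 0)"
        by simp
    qed
    finally show ?thesis using e0 by (simp add: E_def)
  qed
  have val: "(\<Sum>(k, j)\<in>C. t (k, j) * chain_val L (k, \<zeta> j) v) = u v" if v: "v \<in> V" for v
  proof -
    have "\<exists>k\<in>{1..<L}. \<exists>e\<in>E. e \<noteq> 0 \<and> v = coord L k e"
    proof (cases v)
      case (Gen i m)
      with v V D[OF v] have "i \<in> {1..<L}" "m \<ge> 1" "m \<le> D" by (auto simp: gens_def ord_def)
      with Gen show ?thesis
        by (intro bexI[of _ i] bexI[of _ "int m"]) (auto simp: coord_def E_def)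
    next
      case (GenBar i m)
      with v V D[OF v] have "i \<in> {1..<L}" "m \<ge> 1" "m \<le> D" by (auto simp: gens_def ord_def)
      with GenBar show ?thesis
        by (intro bexI[of _ "L - i"] bexI[of _ "- int m"]) (auto simp: coord_def E_def)
    qed
    with val show ?thesis by blast
  qed
  have "poly_eval (\<lambda>v. 0 + (\<Sum>c\<in>C. t c * chain_val L (fst c, \<zeta> (snd c)) v)) g = 0"
  proof (rule poly_eval_span_eq_0[of C "\<lambda>_. 0" "\<lambda>c. chain_val L (fst c, \<zeta> (snd c))" g t])
    fix cs :: "(nat \<times> nat) list" assume cs: "set cs \<subseteq> C"
    have "poly_eval (\<lambda>v. \<Sum>c\<leftarrow>map (\<lambda>c. (fst c, \<zeta> (snd c))) cs. chain_val L c v) g = 0"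
    proof (rule poly_eval_unit_chains[OF adm])
      fix c assume "c \<in> set (map (\<lambda>c. (fst c, \<zeta> (snd c))) cs)"
      with cs show "fst c \<in> {1..<L} \<and> norm (snd c) = 1"
        by (auto simp: C_def \<zeta>_def)
    qed
    then show "poly_eval (\<lambda>v. 0 + (\<Sum>c\<leftarrow>cs. chain_val L (fst c, \<zeta> (snd c)) v)) g = 0"
      by (simp add: comp_def)
  qed (simp add: C_def)
  also have "poly_eval (\<lambda>v. 0 + (\<Sum>c\<in>C. t c * chain_val L (fst c, \<zeta> (snd c)) v)) g = poly_eval u g"
    unfolding poly_eval_def monom_eval_def
  proof (intro sum.cong refl arg_cong2[of _ _ _ _ "(*)"] prod.cong arg_cong2[of _ _ _ _ "(^)"])
    fix m v assume "m \<in> Poly_Mapping.keys g" "v \<in> Poly_Mapping.keys m"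
    then have "v \<in> V" by (auto simp: V_def)
    from val[OF this] show "0 + (\<Sum>c\<in>C. t c * chain_val L (fst c, \<zeta> (snd c)) v) = u v"
      by (simp add: case_prod_unfold)
  qed
  finally show "poly_eval u g = 0" .
qed

section \<open>The limit of large \<open>a\<close>\<close>

text \<open>The real factors \<open>L + 1 - 2 * s\<close> are the coordinates of the sum of the
  positive roots. The factor \<open>- \<i>\<close> makes \<open>omega_pow L (ray L \<tau> s)\<close>
  positive and, for \<open>\<tau> > 0\<close>, decreasing in \<open>s\<close> on
  \<open>{1..L}\<close>.\<close>

definition ray :: "nat \<Rightarrow> real \<Rightarrow> nat \<Rightarrow> complex" where
  "ray L \<tau> s = (if s \<in> {1..L} then - \<i> * of_real (\<tau> * (real L + 1 - 2 * real s)) else 0)"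

lemma ray_in_hdual: "ray L \<tau> \<in> hdual L"
proof -
  have "(\<Sum>s=1..L. real L + 1 - 2 * real s) = L * (L + 1) - 2 * (\<Sum>s=1..L. real s)"
    by (simp add: sum_subtractf sum_distrib_left distrib_left)
  then have "(\<Sum>s=1..L. real L + 1 - 2 * real s) = 0"
    using double_gauss_sum_from_Suc_0[of L, where 'a = real] by (simp add: algebra_simps)
  then have "(\<Sum>s=1..L. - \<i> * of_real (\<tau> * (real L + 1 - 2 * real s))) = 0"
    by (simp only: sum_distrib_left[symmetric] of_real_sum[symmetric]) simp
  moreover have "(\<Sum>s=1..L. ray L \<tau> s) = (\<Sum>s=1..L. - \<i> * of_real (\<tau> * (real L + 1 - 2 * real s)))"
    by (intro sum.cong) (auto simp: ray_def)
  ultimately have "(\<Sum>s=1..L. ray L \<tau> s) = 0" by simp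
  then show ?thesis by (simp add: hdual_def ray_def)
qed

text \<open>
  The exponential prefactor normalises the term that dominates along \<open>ray L\<close>, the one with
  \<open>s = min_index xs\<close>.
\<close>

definition J_row ::
    "nat \<Rightarrow> real \<Rightarrow> (nat \<times> complex) list \<Rightarrow> (gen \<Rightarrow>\<^sub>0 nat) \<Rightarrow> (nat \<Rightarrow> complex) \<Rightarrow> complex" where
  "J_row L p cs m a = (let xs = particles L cs in
     omega_pow L (- (\<Sum>n=1..length xs. a (min_index xs n)))
     * J_num L p a (Poly_Mapping.single m 1) (length xs) (chain_pos xs))"

definition J_row_limit :: "nat \<Rightarrow> real \<Rightarrow> (nat \<times> complex) list \<Rightarrow> (gen \<Rightarrow>\<^sub>0 nat) \<Rightarrow> complex" where
  "J_row_limit L p cs m = (let xs = particles L cs in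
     (\<Prod>n=1..length xs. \<Prod>m=1..<n. pair_num L p (min_index xs m) (min_index xs n) (chain_pos xs m) (chain_pos xs n))
     * monom_eval (\<lambda>v. \<Sum>c\<leftarrow>cs. chain_val L c v) m)"

text \<open>The exponent is written with \<open>(-1) *\<close> and \<open>* (1 / of_nat L)\<close>
  to fit the closure rules used in \<open>entire_J_row\<close>.\<close>

lemma J_row_altdef:
  assumes xs: "xs = particles L cs"
  shows "J_row L p cs m a =
    (\<Sum>s\<in>{1..length xs} \<rightarrow>\<^sub>E {1..L}.
       exp (2 * of_real pi * \<i> * ((\<Sum>n=1..length xs. a (s n)) + (-1) * (\<Sum>n=1..length xs. a (min_index xs n))) * (1 / of_nat L))
       * ((\<Prod>n=1..length xs. \<Prod>m=1..<n. pair_num L p (s m) (s n) (chain_pos xs m) (chain_pos xs n))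
          * monom_eval (\<lambda>v. \<Sum>n=1..length xs. particle_val L (s n) (chain_pos xs n) v) m))"
proof -
  have "exp (2 * of_real pi * \<i> * (b + (-1) * c) * (1 / of_nat L)) = omega_pow L (- c) * omega_pow L b" for b c
    unfolding omega_pow_add[symmetric] by (simp add: omega_pow_def)
  then show ?thesis
    unfolding J_row_def Let_def J_num_def xs[symmetric] poly_eval_single
    by (subst sum_distrib_left) (simp only: mult_1_left mult.assoc)
qed

lemma entire_J_row: "entire_on_hdual L (J_row L p cs m)"
  unfolding J_row_altdef[OF refl, abs_def]
  by (intro entire_on_hdual_sum entire_on_hdual_mult entire_on_hdual_exp entire_on_hdual_add
      entire_on_hdual_const entire_on_hdual_coord)

text \<open>After normalisation the term of \<open>s\<close> carries the factor
  \<open>exp (- (4 * pi / L * d s) * \<tau>)\<close>, where \<open>d s\<close> is the total excess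
  of \<open>s\<close> over \<open>min_index xs\<close>. For every other term with nonzero pair
  product this excess is positive.\<close>

lemma tendsto_J_row:
  assumes L: "L > 0" and cs: "admissible L cs" and m: "Poly_Mapping.keys m \<subseteq> gens L"
  shows "((\<lambda>\<tau>. J_row L p cs m (ray L \<tau>)) \<longlongrightarrow> J_row_limit L p cs m) at_top"
proof -
  define xs where "xs = particles L cs"
  define N where "N = length xs"
  define P where "P s = (\<Prod>n=1..N. \<Prod>m=1..<n. pair_num L p (s m) (s n) (chain_pos xs m) (chain_pos xs n))" for s
  define Q where "Q s = P s * monom_eval (\<lambda>v. \<Sum>n=1..N. particle_val L (s n) (chain_pos xs n) v) m" for s
  define d where "d s = (\<Sum>n=1..N. real (s n) - real (min_index xs n))" for s
  have min_index: "min_index xs \<in> {1..N} \<rightarrow>\<^sub>E {1..L}"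
    unfolding N_def using min_index_in_PiE[OF cs xs_def] .
  have "monom_eval (\<lambda>v. \<Sum>n=1..N. particle_val L (min_index xs n) (chain_pos xs n) v) m
      = monom_eval (\<lambda>v. \<Sum>c\<leftarrow>cs. chain_val L c v) m"
    unfolding monom_eval_def N_def using m
    by (intro prod.cong refl arg_cong2[of _ _ _ _ "(^)"] sum_particle_val[OF cs _ xs_def]) auto
  then have limit: "J_row_limit L p cs m = Q (min_index xs)"
    by (simp add: J_row_limit_def Let_def Q_def P_def xs_def N_def)
  have row: "J_row L p cs m (ray L \<tau>) = (\<Sum>s\<in>{1..N} \<rightarrow>\<^sub>E {1..L}. of_real (exp (- (4 * pi / L * d s) * \<tau>)) * Q s)" for \<tau>
    unfolding J_row_altdef[OF xs_def] N_def[symmetric] P_def[symmetric] Q_def[symmetric]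
  proof (intro sum.cong refl arg_cong2[of _ _ _ _ "(*)"])
    fix s assume s: "s \<in> {1..N} \<rightarrow>\<^sub>E {1..L}"
    have "(\<Sum>n=1..N. ray L \<tau> (s n)) + (-1) * (\<Sum>n=1..N. ray L \<tau> (min_index xs n))
        = (\<Sum>n=1..N. ray L \<tau> (s n) - ray L \<tau> (min_index xs n))"
      by (simp add: sum_subtractf)
    also have "\<dots> = (\<Sum>n=1..N. 2 * \<i> * of_real \<tau> * of_real (real (s n) - real (min_index xs n)))"
    proof (intro sum.cong refl)
      fix n assume "n \<in> {1..N}"
      then have "s n \<in> {1..L}" "min_index xs n \<in> {1..L}" using s min_index by (auto simp: PiE_def Pi_def)
      then show "ray L \<tau> (s n) - ray L \<tau> (min_index xs n) = 2 * \<i> * of_real \<tau> * of_real (real (s n) - real (min_index xs n))"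
        by (simp add: ray_def algebra_simps)
    qed
    also have "\<dots> = 2 * \<i> * of_real \<tau> * of_real (d s)"
      by (simp only: d_def of_real_sum sum_distrib_left)
    finally have eq: "(\<Sum>n=1..N. ray L \<tau> (s n)) + (-1) * (\<Sum>n=1..N. ray L \<tau> (min_index xs n)) = 2 * \<i> * of_real \<tau> * of_real (d s)" .
    have "2 * of_real pi * \<i> * (2 * \<i> * of_real \<tau> * of_real (d s)) * (1 / of_nat L)
        = of_real (- (4 * pi / L * d s) * \<tau>)"
      by (simp add: mult_ac)
    then show "exp (2 * of_real pi * \<i> * ((\<Sum>n=1..N. ray L \<tau> (s n)) + (-1) * (\<Sum>n=1..N. ray L \<tau> (min_index xs n))) * (1 / of_nat L))
        = of_real (exp (- (4 * pi / L * d s) * \<tau>))"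
      unfolding eq by (simp only: exp_of_real)
  qed
  have "((\<lambda>\<tau>. \<Sum>s\<in>{1..N} \<rightarrow>\<^sub>E {1..L}. of_real (exp (- (4 * pi / L * d s) * \<tau>)) * Q s) \<longlongrightarrow>
      (\<Sum>s\<in>{1..N} \<rightarrow>\<^sub>E {1..L}. if s = min_index xs then Q (min_index xs) else 0)) at_top"
  proof (intro tendsto_sum)
    fix s assume s: "s \<in> {1..N} \<rightarrow>\<^sub>E {1..L}"
    \<comment> \<open>Terms with \<open>P s = 0\<close> are set apart, as the pointwise bound that
      gives \<open>d s > 0\<close> needs \<open>P s\<close> nonzero.\<close>
    consider "s = min_index xs" | "s \<noteq> min_index xs" "P s = 0" | "s \<noteq> min_index xs" "P s \<noteq> 0" by blast
    then show "((\<lambda>\<tau>. of_real (exp (- (4 * pi / L * d s) * \<tau>)) * Q s) \<longlongrightarrow>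
        (if s = min_index xs then Q (min_index xs) else 0)) at_top"
    proof cases
      case 1
      then show ?thesis by (simp add: d_def)
    next
      case 2
      then show ?thesis by (simp add: Q_def)
    next
      case 3
      have le: "min_index xs n \<le> s n" if "n \<in> {1..N}" for n
        using 3 s that unfolding P_def N_def by (intro min_index_le_of_nonzero[OF xs_def]) auto
      obtain n where n: "n \<in> {1..N}" "s n \<noteq> min_index xs n"
        using 3 s min_index by (meson PiE_ext)
      have "d s > 0"
        unfolding d_def using le n by (intro sum_pos2[of _ n]) (auto simp: le_neq_implies_less)
      then have "0 < 4 * pi / L * d s" using L by simp
      then have "LIM \<tau> at_top. (4 * pi / L * d s) * \<tau> :> at_top"
        by (rule filterlim_tendsto_pos_mult_at_top[OF tendsto_const _ filterlim_ident])
      then have "LIM \<tau> at_top. - (4 * pi / L * d s) * \<tau> :> at_bot"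
        by (simp add: filterlim_uminus_at_bot)
      then have "((\<lambda>\<tau>. exp (- (4 * pi / L * d s) * \<tau>)) \<longlongrightarrow> 0) at_top"
        by (rule filterlim_compose[OF exp_at_bot])
      then have "((\<lambda>\<tau>. of_real (exp (- (4 * pi / L * d s) * \<tau>)) * Q s) \<longlongrightarrow> of_real 0 * Q s) at_top"
        by (intro tendsto_intros)
      with 3 show ?thesis by simp
    qed
  qed
  also have "(\<Sum>s\<in>{1..N} \<rightarrow>\<^sub>E {1..L}. if s = min_index xs then Q (min_index xs) else 0) = Q (min_index xs)"
    using min_index by (simp add: finite_PiE)
  finally show ?thesis unfolding row limit .
qed

text \<open>For fixed \<open>cs\<close> the limits share a nonzero factor, so a relation among them
  is a polynomial that vanishes on all admissible chains.\<close>

lemma J_row_limits_independent: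
  assumes "L > 0" "p \<notin> \<rat>" "finite M" "\<And>m. m \<in> M \<Longrightarrow> Poly_Mapping.keys m \<subseteq> gens L"
    and h: "\<And>cs. admissible L cs \<Longrightarrow> (\<Sum>m\<in>M. h m * J_row_limit L p cs m) = 0"
  shows "\<forall>m\<in>M. h m = 0"
proof -
  define g where "g = (\<Sum>m\<in>M. Poly_Mapping.single m (h m))"
  have lookup: "Poly_Mapping.lookup g m = (if m \<in> M then h m else 0)" for m
    using assms(3) by (simp add: g_def lookup_sum lookup_single when_def)
  have "g = 0"
  proof (rule chains_separate_polynomials)
    fix cs assume cs: "admissible L cs"
    define xs where "xs = particles L cs"
    define P where "P = (\<Prod>n=1..length xs. \<Prod>m=1..<n. pair_num L p (min_index xs m) (min_index xs n) (chain_pos xs m) (chain_pos xs n))"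
    have "P * poly_eval (\<lambda>v. \<Sum>c\<leftarrow>cs. chain_val L c v) g = (\<Sum>m\<in>M. h m * J_row_limit L p cs m)"
      by (simp add: g_def poly_eval_sum poly_eval_single J_row_limit_def Let_def P_def xs_def sum_distrib_left sum_distrib_right mult_ac)
    moreover have "P \<noteq> 0"
      unfolding P_def using assms cs by (intro prod_pair_num_min_index_nonzero[OF _ _ cs xs_def])
    ultimately show "poly_eval (\<lambda>v. \<Sum>c\<leftarrow>cs. chain_val L c v) g = 0"
      using h[OF cs] by simp
  next
    show "g \<in> algebra_AA L"
      unfolding algebra_AA_def
    proof (intro CollectI ballI)
      fix m assume "m \<in> Poly_Mapping.keys g"
      then have "m \<in> M" by (auto simp: in_keys_iff lookup split: if_splits)
      with assms(4) show "Poly_Mapping.keys m \<subseteq> gens L" .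
    qed
  qed
  then show ?thesis using lookup by (metis lookup_zero)
qed

section \<open>Countably many finite supports, and generic injectivity\<close>

lemma countable_monomials: "countable (UNIV :: (gen \<Rightarrow>\<^sub>0 nat) set)"
proof -
  have gen: "countable (UNIV :: gen set)"
  proof -
    have "UNIV = range (case_prod Gen) \<union> range (case_prod GenBar)"
      by (auto simp: image_iff) (metis gen.exhaust)
    then show ?thesis by (metis countable_Un countable_image countableI_type)
  qed
  \<comment> \<open>The finite graph over the support determines the monomial.\<close>
  define graph where "graph m = (\<lambda>v. (v, Poly_Mapping.lookup m v)) ` Poly_Mapping.keys m" for m :: "gen \<Rightarrow>\<^sub>0 nat"
  have "inj graph"
  proof (rule injI, rule poly_mapping_eqI)
    fix m m' v assume eq: "graph m = graph m'"
    have "(v, k) \<in> graph m \<longleftrightarrow> k = Poly_Mapping.lookup m v \<and> k \<noteq> 0" for m k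
      by (auto simp: graph_def in_keys_iff)
    with eq show "Poly_Mapping.lookup m v = Poly_Mapping.lookup m' v" by metis
  qed
  moreover have "countable (range graph)"
  proof (rule countable_subset)
    show "range graph \<subseteq> {A. finite A \<and> A \<subseteq> (UNIV :: gen set) \<times> (UNIV :: nat set)}"
      by (auto simp: graph_def)
    show "countable {A. finite A \<and> A \<subseteq> (UNIV :: gen set) \<times> (UNIV :: nat set)}"
      using gen by (intro countable_Collect_finite_subset countable_SIGMA) auto
  qed
  ultimately show ?thesis by (simp add: countable_image_inj_eq)
qed

theorem theorem1:
  fixes L :: nat and p :: real
  assumes "L \<ge> 2" and "0 < p" and "p < 1" and "p \<notin> \<rat>"
  shows "for_generic L (\<lambda>a. inj_on (form_factors L p a) (algebra_AA L))"
proof -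
  define \<M> where "\<M> = {M. finite M \<and> M \<subseteq> {m :: gen \<Rightarrow>\<^sub>0 nat. Poly_Mapping.keys m \<subseteq> gens L}}"
  have "\<exists>F. entire_on_hdual L F \<and> (\<exists>b\<in>hdual L. F b \<noteq> 0) \<and>
      (\<forall>a h. F a \<noteq> 0 \<longrightarrow> (\<forall>cs. admissible L cs \<longrightarrow> (\<Sum>m\<in>M. h m * J_row L p cs m a) = 0) \<longrightarrow> (\<forall>m\<in>M. h m = 0))"
    if M: "M \<in> \<M>" for M
  proof -
    have *: "finite M" "\<And>m. m \<in> M \<Longrightarrow> Poly_Mapping.keys m \<subseteq> gens L"
      using M by (auto simp: \<M>_def)
    have "\<exists>F c. entire_on_hdual L F \<and> ((\<lambda>\<tau>. F (ray L \<tau>)) \<longlongrightarrow> c) at_top \<and> c \<noteq> 0 \<and>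
        (\<forall>a h. F a \<noteq> 0 \<longrightarrow> (\<forall>cs\<in>Collect (admissible L). (\<Sum>m\<in>M. h m * J_row L p cs m a) = 0) \<longrightarrow> (\<forall>m\<in>M. h m = 0))"
    proof (rule generic_independence)
      fix h assume "\<And>cs. cs \<in> Collect (admissible L) \<Longrightarrow> (\<Sum>m\<in>M. h m * J_row_limit L p cs m) = 0"
      then show "\<forall>m\<in>M. h m = 0"
        using assms * by (intro J_row_limits_independent[of L p M h]) auto
    next
      fix cs m assume "cs \<in> Collect (admissible L)" "m \<in> M"
      then show "((\<lambda>\<tau>. J_row L p cs m (ray L \<tau>)) \<longlongrightarrow> J_row_limit L p cs m) at_top"
        using assms(1) * by (intro tendsto_J_row) auto
    next
      show "finite M" by fact
      show "entire_on_hdual L (J_row L p cs m)" for cs m by (rule entire_J_row)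
    qed
    then obtain F c where F: "entire_on_hdual L F" "((\<lambda>\<tau>. F (ray L \<tau>)) \<longlongrightarrow> c) at_top" "c \<noteq> 0"
      "\<forall>a h. F a \<noteq> 0 \<longrightarrow> (\<forall>cs. admissible L cs \<longrightarrow> (\<Sum>m\<in>M. h m * J_row L p cs m a) = 0) \<longrightarrow> (\<forall>m\<in>M. h m = 0)"
      by auto
    \<comment> \<open>The nonzero limit provides a point of the ray at which \<open>F\<close> is
      nonzero.\<close>
    have "\<forall>\<^sub>F \<tau> in at_top. F (ray L \<tau>) \<noteq> 0"
      using F by (intro tendsto_imp_eventually_ne)
    then obtain \<tau> where "F (ray L \<tau>) \<noteq> 0"
      using eventually_happens[of _ "at_top :: real filter"] by auto
    with F ray_in_hdual show ?thesis by (intro exI[of _ F]) auto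
  qed
  then have "\<forall>M\<in>\<M>. \<exists>F. entire_on_hdual L F \<and> (\<exists>b\<in>hdual L. F b \<noteq> 0) \<and>
      (\<forall>a h. F a \<noteq> 0 \<longrightarrow> (\<forall>cs. admissible L cs \<longrightarrow> (\<Sum>m\<in>M. h m * J_row L p cs m a) = 0) \<longrightarrow> (\<forall>m\<in>M. h m = 0))"
    by blast
  \<comment> \<open>One exceptional function for each finite set of monomials.\<close>
  from bchoice[OF this] obtain F where F: "\<forall>M\<in>\<M>. entire_on_hdual L (F M) \<and> (\<exists>b\<in>hdual L. F M b \<noteq> 0) \<and>
      (\<forall>a h. F M a \<noteq> 0 \<longrightarrow> (\<forall>cs. admissible L cs \<longrightarrow> (\<Sum>m\<in>M. h m * J_row L p cs m a) = 0) \<longrightarrow> (\<forall>m\<in>M. h m = 0))"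
    by blast
  have "inj_on (form_factors L p a) (algebra_AA L)" if a: "a \<in> hdual L" "\<forall>M\<in>\<M>. F M a \<noteq> 0" for a
  proof
    fix g h assume gh: "g \<in> algebra_AA L" "h \<in> algebra_AA L" "form_factors L p a g = form_factors L p a h"
    define d where "d = g - h"
    have "form_factors L p a d X = 0" for X
      using form_factors_add[of L p a d h X] gh by (simp add: d_def)
    then have zero: "form_factors L p a d = (\<lambda>_. 0)" by blast
    \<comment> \<open>The support of the difference selects the function that excludes it as a
      nontrivial relation.\<close>
    have "Poly_Mapping.keys d \<in> \<M>"
      using gh keys_diff[of g h] by (auto simp: \<M>_def d_def algebra_AA_def)
    moreover have "(\<Sum>m\<in>Poly_Mapping.keys d. Poly_Mapping.lookup d m * J_row L p cs m a) = 0" if "admissible L cs" for cs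
    proof -
      define xs where "xs = particles L cs"
      have "(\<Sum>m\<in>Poly_Mapping.keys d. Poly_Mapping.lookup d m * J_row L p cs m a)
          = omega_pow L (- (\<Sum>n=1..length xs. a (min_index xs n))) *
            (\<Sum>m\<in>Poly_Mapping.keys d. Poly_Mapping.lookup d m * J_num L p a (Poly_Mapping.single m 1) (length xs) (chain_pos xs))"
        by (simp add: J_row_def xs_def Let_def sum_distrib_left mult_ac)
      \<comment> \<open>Linearity of \<open>J_num\<close> in the polynomial reassembles
        \<open>d\<close> from its monomials.\<close>
      also have "(\<Sum>m\<in>Poly_Mapping.keys d. Poly_Mapping.lookup d m * J_num L p a (Poly_Mapping.single m 1) (length xs) (chain_pos xs))
          = J_num L p a d (length xs) (chain_pos xs)"
        unfolding J_num_def sum_distrib_left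
        by (subst sum.swap) (simp add: poly_eval_single poly_eval_def[of _ d] sum_distrib_left sum_distrib_right mult_ac)
      also have "\<dots> = 0"
        using assms a zero that unfolding xs_def by (intro J_num_eq_0 chain_pos_nonzero) auto
      finally show ?thesis by simp
    qed
    ultimately have "\<forall>m\<in>Poly_Mapping.keys d. Poly_Mapping.lookup d m = 0"
      using a F by blast
    then have "d = 0" by (intro poly_mapping_eqI) (auto simp: in_keys_iff)
    then show "g = h" by (simp add: d_def)
  qed
  moreover have "countable \<M>"
    unfolding \<M>_def
    by (rule countable_Collect_finite_subset[OF countable_subset[OF subset_UNIV countable_monomials]])
  ultimately show ?thesis
    unfolding for_generic_def using F by (intro exI[of _ "F ` \<M>"]) auto
qed

end
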